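(* Let $g$ be the accelerating Kerr metric with real parameters $a,\alpha$ and $m\neq0$ (see context). Then the invariant $$Q_2=\frac1{27}\,\frac{I_5I_6-I_7^2}{(I_1^2+I_2^2)^{5/2}}$$ of $g$ equals $$Q_2=-\frac{(a^2-2mr+r^2)\left(a^2\alpha^2\cos^2\theta-2\alpha m\cos\theta+1\right)\sin^2\theta\;a^2\,(\alpha r\cos\theta+1)^2(\alpha^2r^2-1)}{(\alpha r\cos\theta-1)^4\,(r^2+a^2\cos^2\theta)\,m^2\,(a^2\alpha^2+1)}.$$
   Context: Accelerating Kerr black hole metric: in coordinates $(t,r,\theta,\phi)$, signature $(-,+,+,+)$, $$ds^2=\frac1{\Omega^2}\Big\{-\frac{Q}{\rho^2}\big[dt-a\sin^2\theta\,d\phi\big]^2+\frac{\rho^2}{Q}dr^2+\frac{\rho^2}{P}d\theta^2+\frac{P}{\rho^2}\sin^2\theta\big[a\,dt-(r^2+a^2)d\phi\big]^2\Big\},$$ $\Omega=1-\alpha r\cos\theta$, $\rho^2=r^2+a^2\cos^2\theta$, $P=1-2\alpha m\cos\theta+\alpha^2a^2\cos^2\theta$, $Q=(a^2-2mr+r^2)(1-\alpha^2r^2)$, on the domain where the metric is regular ($\Omega>0$, $\rho^2\ne0$, $Q\neq0$, $P>0$, $\sin\theta\neq0$). With $C_{\kappa\lambda\mu\nu}$ the Weyl tensor and $C^*_{\kappa\lambda\mu\nu}=\frac12E_{\kappa\lambda\sigma\tau}C^{\sigma\tau}{}_{\mu\nu}$ its dual ($E$ the Levi-Civita pseudotensor;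 $Q_2$ does not depend on orientation): $I_1=C_{\kappa\lambda\mu\nu}C^{\kappa\lambda\mu\nu}$, $I_2=C^*_{\kappa\lambda\mu\nu}C^{\kappa\lambda\mu\nu}$, $k_\mu=-\nabla_\mu I_1$, $l_\mu=-\nabla_\mu I_2$, $I_5=k_\mu k^\mu$, $I_6=l_\mu l^\mu$, $I_7=k_\mu l^\mu$. *)

theory Defs
  imports "HOL-Analysis.Analysis"
begin

text \<open>
  Tensor calculus in one coordinate chart of a four-dimensional spacetime. Points are coordinate
  vectors in \<^typ>\<open>real^4\<close>, tensor indices range over the type \<^typ>\<open>4\<close> = {1, 2, 3, 4}, and a metric
  is given by its matrix of covariant components at each point.
  Riemann convention: R^a_bcd = d_c Gamma^a_db - d_d Gamma^a_cb + Gamma Gamma - Gamma Gamma,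
  R_bd = R^a_bad, signature (-,+,+,+).
\<close>

type_synonym metric = "real^4 \<Rightarrow> real^4^4"
type_synonym tensor4 = "real^4 \<Rightarrow> 4 \<Rightarrow> 4 \<Rightarrow> 4 \<Rightarrow> 4 \<Rightarrow> real"

definition partial :: "4 \<Rightarrow> (real^4 \<Rightarrow> real) \<Rightarrow> real^4 \<Rightarrow> real" where
  "partial i f x = deriv (\<lambda>s. f (x + s *\<^sub>R axis i 1)) 0"

definition inv_metric :: "metric \<Rightarrow> metric" where
  "inv_metric g x = matrix_inv (g x)"

definition christoffel :: "metric \<Rightarrow> real^4 \<Rightarrow> 4 \<Rightarrow> 4 \<Rightarrow> 4 \<Rightarrow> real" where
  "christoffel g x c a b = (1/2) * (\<Sum>d\<in>UNIV. inv_metric g x $ c $ d *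
     (partial a (\<lambda>y. g y $ b $ d) x + partial b (\<lambda>y. g y $ a $ d) x - partial d (\<lambda>y. g y $ a $ b) x))"

text \<open>The first index of \<open>riemann_up\<close> is the contravariant one.\<close>

definition riemann_up :: "metric \<Rightarrow> tensor4" where
  "riemann_up g x a b c d =
     partial c (\<lambda>y. christoffel g y a d b) x - partial d (\<lambda>y. christoffel g y a c b) x
     + (\<Sum>e\<in>UNIV. christoffel g x a c e * christoffel g x e d b
                  - christoffel g x a d e * christoffel g x e c b)"

definition riemann :: "metric \<Rightarrow> tensor4" where
  "riemann g x a b c d = (\<Sum>e\<in>UNIV. g x $ a $ e * riemann_up g x e b c d)"

definition ricci :: "metric \<Rightarrow> real^4 \<Rightarrow> 4 \<Rightarrow> 4 \<Rightarrow> real" where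
  "ricci g x b d = (\<Sum>a\<in>UNIV. riemann_up g x a b a d)"

definition scalar_curvature :: "metric \<Rightarrow> real^4 \<Rightarrow> real" where
  "scalar_curvature g x = (\<Sum>a\<in>UNIV. \<Sum>b\<in>UNIV. inv_metric g x $ a $ b * ricci g x a b)"

text \<open>The coefficients 1/2 and 1/6 are 1/(n-2) and 1/((n-1)(n-2)) for n = 4.\<close>

definition weyl :: "metric \<Rightarrow> tensor4" where
  "weyl g x a b c d = riemann g x a b c d
     - (1/2) * (g x $ a $ c * ricci g x b d - g x $ a $ d * ricci g x b c
                - g x $ b $ c * ricci g x a d + g x $ b $ d * ricci g x a c)
     + (1/6) * scalar_curvature g x * (g x $ a $ c * g x $ b $ d - g x $ a $ d * g x $ b $ c)"

definition levi_civita_symbol :: "4 \<Rightarrow> 4 \<Rightarrow> 4 \<Rightarrow> 4 \<Rightarrow> real" where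
  "levi_civita_symbol a b c d =
     (let p = id(1 := a, 2 := b, 3 := c, 4 := d)
      in if p permutes UNIV then of_int (sign p) else 0)"

definition levi_civita :: "metric \<Rightarrow> tensor4" where
  "levi_civita g x a b c d = sqrt \<bar>det (g x)\<bar> * levi_civita_symbol a b c d"

text \<open>\<open>raise_first g T\<close> has components T^ab_cd, \<open>raise_all g T\<close> has components T^abcd.\<close>

definition raise_first :: "metric \<Rightarrow> tensor4 \<Rightarrow> tensor4" where
  "raise_first g T x a b c d =
     (\<Sum>p\<in>UNIV. \<Sum>q\<in>UNIV. inv_metric g x $ a $ p * inv_metric g x $ b $ q * T x p q c d)"

definition raise_all :: "metric \<Rightarrow> tensor4 \<Rightarrow> tensor4" where
  "raise_all g T x a b c d =
     (\<Sum>p\<in>UNIV. \<Sum>q\<in>UNIV. inv_metric g x $ c $ p * inv_metric g x $ d $ q * raise_first g T x a b p q)"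

definition dual_weyl :: "metric \<Rightarrow> tensor4" where
  "dual_weyl g x a b c d =
     (1/2) * (\<Sum>s\<in>UNIV. \<Sum>t\<in>UNIV. levi_civita g x a b s t * raise_first g (weyl g) x s t c d)"

definition inv_I1 :: "metric \<Rightarrow> real^4 \<Rightarrow> real" where
  "inv_I1 g x = (\<Sum>a\<in>UNIV. \<Sum>b\<in>UNIV. \<Sum>c\<in>UNIV. \<Sum>d\<in>UNIV.
     weyl g x a b c d * raise_all g (weyl g) x a b c d)"

definition inv_I2 :: "metric \<Rightarrow> real^4 \<Rightarrow> real" where
  "inv_I2 g x = (\<Sum>a\<in>UNIV. \<Sum>b\<in>UNIV. \<Sum>c\<in>UNIV. \<Sum>d\<in>UNIV.
     dual_weyl g x a b c d * raise_all g (weyl g) x a b c d)"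

text \<open>On scalars the covariant derivative is the partial derivative.\<close>

definition covec_k :: "metric \<Rightarrow> real^4 \<Rightarrow> real^4" where
  "covec_k g x = (\<chi> i. - partial i (inv_I1 g) x)"

definition covec_l :: "metric \<Rightarrow> real^4 \<Rightarrow> real^4" where
  "covec_l g x = (\<chi> i. - partial i (inv_I2 g) x)"

definition contract :: "metric \<Rightarrow> real^4 \<Rightarrow> real^4 \<Rightarrow> real^4 \<Rightarrow> real" where
  "contract g x u v = (\<Sum>a\<in>UNIV. \<Sum>b\<in>UNIV. inv_metric g x $ a $ b * (u $ a * v $ b))"

definition inv_I5 :: "metric \<Rightarrow> real^4 \<Rightarrow> real" where
  "inv_I5 g x = contract g x (covec_k g x) (covec_k g x)"

definition inv_I6 :: "metric \<Rightarrow> real^4 \<Rightarrow> real" where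
  "inv_I6 g x = contract g x (covec_l g x) (covec_l g x)"

definition inv_I7 :: "metric \<Rightarrow> real^4 \<Rightarrow> real" where
  "inv_I7 g x = contract g x (covec_k g x) (covec_l g x)"

definition inv_Q2 :: "metric \<Rightarrow> real^4 \<Rightarrow> real" where
  "inv_Q2 g x = (1/27) * ((inv_I5 g x * inv_I6 g x - (inv_I7 g x)\<^sup>2)
                          / ((inv_I1 g x)\<^sup>2 + (inv_I2 g x)\<^sup>2) powr (5/2))"

text \<open>The accelerating Kerr metric, in coordinates (t, r, theta, phi) numbered 1, 2, 3, 4.\<close>

definition ak_Omega :: "real \<Rightarrow> real \<Rightarrow> real \<Rightarrow> real" where
  "ak_Omega \<alpha> r \<theta> = 1 - \<alpha> * r * cos \<theta>"

definition ak_rho2 :: "real \<Rightarrow> real \<Rightarrow> real \<Rightarrow> real" where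
  "ak_rho2 a r \<theta> = r\<^sup>2 + a\<^sup>2 * (cos \<theta>)\<^sup>2"

definition ak_P :: "real \<Rightarrow> real \<Rightarrow> real \<Rightarrow> real \<Rightarrow> real" where
  "ak_P a \<alpha> m \<theta> = 1 - 2 * \<alpha> * m * cos \<theta> + \<alpha>\<^sup>2 * a\<^sup>2 * (cos \<theta>)\<^sup>2"

definition ak_Q :: "real \<Rightarrow> real \<Rightarrow> real \<Rightarrow> real \<Rightarrow> real" where
  "ak_Q a \<alpha> m r = (a\<^sup>2 - 2 * m * r + r\<^sup>2) * (1 - \<alpha>\<^sup>2 * r\<^sup>2)"

text \<open>
  \<open>u\<close> and \<open>v\<close> are the one-forms dt - a sin^2(theta) dphi and a dt - (r^2 + a^2) dphi.
\<close>

definition acc_kerr :: "real \<Rightarrow> real \<Rightarrow> real \<Rightarrow> metric" where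
  "acc_kerr a \<alpha> m x =
     (let r = x $ 2; \<theta> = x $ 3;
          \<Omega> = ak_Omega \<alpha> r \<theta>; \<rho>2 = ak_rho2 a r \<theta>; P = ak_P a \<alpha> m \<theta>; Q = ak_Q a \<alpha> m r;
          dt = axis 1 1; dr = axis 2 1; d\<theta> = axis 3 1; d\<phi> = axis 4 1;
          u = dt - (a * (sin \<theta>)\<^sup>2) *\<^sub>R d\<phi>;
          v = a *\<^sub>R dt - (r\<^sup>2 + a\<^sup>2) *\<^sub>R d\<phi>
      in \<chi> i j. (1 / \<Omega>\<^sup>2) *
           (- (Q / \<rho>2) * (u $ i * u $ j)
            + (\<rho>2 / Q) * (dr $ i * dr $ j)
            + (\<rho>2 / P) * (d\<theta> $ i * d\<theta> $ j)
            + (P / \<rho>2) * (sin \<theta>)\<^sup>2 * (v $ i * v $ j)))"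

definition acc_kerr_domain :: "real \<Rightarrow> real \<Rightarrow> real \<Rightarrow> (real^4) set" where
  "acc_kerr_domain a \<alpha> m =
     {x. ak_Omega \<alpha> (x $ 2) (x $ 3) > 0 \<and> ak_rho2 a (x $ 2) (x $ 3) \<noteq> 0 \<and>
         ak_Q a \<alpha> m (x $ 2) \<noteq> 0 \<and> ak_P a \<alpha> m (x $ 3) > 0 \<and> sin (x $ 3) \<noteq> 0}"

end

theory Submission
  imports Defs
begin

text \<open>
  Everything depends only on r and c = cos theta, and in the coframe u, dr/Q, dc/X, v with
  X = P sin^2 theta the metric is diagonal and all connection coefficients are polynomials in
  r, c, 1/rho^2, 1/Omega, Q, X and their derivatives. Cartan's structure equations then show that
  the metric is Ricci flat and that its Weyl tensor is of type D, with the single complex scalar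
  kappa + i Y = m (1 + i alpha a) (Omega / (r - i a c))^3, so that
  I1 + i I2 = 48 (kappa -+ i Y)^2, the sign depending on the orientation. The numerator of Q2 is the Gram determinant of dI1 and dI2, that
  is g^rr g^(theta theta) times the squared Jacobian of (I1, I2) in (r, theta), and this Jacobian
  is read off from the logarithmic derivative of Omega / (r - i a c).
\<close>

section \<open>The Levi-Civita symbol\<close>

text \<open>An orthonormal coframe would bring in square roots of Q and P, and a case distinction as
  well, since the domain allows both signs of Q. Leaving these factors in a nonconstant diagonal
  frame metric avoids both: half the logarithmic derivatives of its entries become the diagonal
  connection coefficients, and every check is a polynomial identity modulo relations such as rho^2 *
  \<open>R\<close> = 1. The second obstacle is orientation. \<open>levi_civita\<close> carries the
  positive root of |det g|, while the determinant of the coframe changes sign with sin theta. Hence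
  I2 acquires the factor sgn (sin theta), which is locally constant and disappears in all squares.
  The Jacobian is computed as follows. Put w = Omega / (r - i a c). Its logarithmic derivatives are
  -(\<open>lr\<close> + i a c \<open>R\<close>) in r and -\<open>lc\<close> + i a r \<open>R\<close>
  in c. As I1 + i I2 is, up to conjugation, a constant times w^6, the Jacobian of (I1, I2) in (r, c)
  is up to sign 36 |I1 + i I2|^2 a \<open>R\<close> (r \<open>lr\<close> + c
  \<open>lc\<close>).\<close>

lemma det_4: "det (A::real^4^4) = 
  A$1$1*A$2$2*A$3$3*A$4$4 - A$1$1*A$2$2*A$3$4*A$4$3 - A$1$1*A$2$3*A$3$2*A$4$4 + A$1$1*A$2$3*A$3$4*A$4$2
  + A$1$1*A$2$4*A$3$2*A$4$3 - A$1$1*A$2$4*A$3$3*A$4$2 - A$1$2*A$2$1*A$3$3*A$4$4 + A$1$2*A$2$1*A$3$4*A$4$3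
  + A$1$2*A$2$3*A$3$1*A$4$4 - A$1$2*A$2$3*A$3$4*A$4$1 - A$1$2*A$2$4*A$3$1*A$4$3 + A$1$2*A$2$4*A$3$3*A$4$1
  + A$1$3*A$2$1*A$3$2*A$4$4 - A$1$3*A$2$1*A$3$4*A$4$2 - A$1$3*A$2$2*A$3$1*A$4$4 + A$1$3*A$2$2*A$3$4*A$4$1
  + A$1$3*A$2$4*A$3$1*A$4$2 - A$1$3*A$2$4*A$3$2*A$4$1 - A$1$4*A$2$1*A$3$2*A$4$3 + A$1$4*A$2$1*A$3$3*A$4$2
  + A$1$4*A$2$2*A$3$1*A$4$3 - A$1$4*A$2$2*A$3$3*A$4$1 - A$1$4*A$2$3*A$3$1*A$4$2 + A$1$4*A$2$3*A$3$2*A$4$1"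
proof -
  have f1234: "finite {2::4, 3, 4}" "1 \<notin> {2::4, 3, 4}" by auto
  have f234: "finite {3::4, 4}" "2 \<notin> {3::4, 4}" by auto
  have f34: "finite {4::4}" "3 \<notin> {4::4}" by auto
  show ?thesis
    unfolding det_def UNIV_4
    unfolding sum_over_permutations_insert[OF f1234] sum_over_permutations_insert[OF f234]
      sum_over_permutations_insert[OF f34]
    unfolding permutes_sing
    by (simp add: sign_swap_id permutation_swap_id sign_compose sign_id swap_id_eq)
       (simp add: permutation_compose permutation_swap_id sign_compose sign_swap_id algebra_simps)
qed

text \<open>For a permutation the 0-1 matrix is the identity with permuted rows; otherwise the index
  map is not injective and two rows agree. In this form the values can be computed with
  \<open>det_4\<close> and products handled with \<open>det_mul\<close>.\<close>

lemma levi_civita_symbol_det: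
  "levi_civita_symbol a b c d = det (\<chi> i j. if j = (id(1 := a, 2 := b, 3 := c, 4 := d)) i then 1 else 0)"
proof -
  define p where "p = (id(1 := a, 2 := b, 3 := c, 4 := d) :: 4 \<Rightarrow> 4)"
  let ?M = "(\<chi> i j. if j = p i then 1 else 0) :: real^4^4"
  have "(if p permutes UNIV then of_int (sign p) else 0) = det ?M"
  proof (cases "p permutes UNIV")
    case True
    have "?M = (\<chi> i. (mat 1 :: real^4^4) $ p i)"
      by (simp add: vec_eq_iff mat_def eq_commute)
    then show ?thesis
      using det_permute_rows[OF True, of "mat 1 :: real^4^4"] True by simp
  next
    case False
    then have "\<not> inj p"
      by (metis UNIV_I bij_betw_def bij_imp_permutes finite_UNIV_inj_surj finite_class.finite_UNIV)
    then obtain i j where "p i = p j" "i \<noteq> j" by (auto simp: inj_def)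
    then have "det ?M = 0"
      by (intro det_identical_rows[of i j]) (auto simp: row_def)
    with False show ?thesis by simp
  qed
  then show ?thesis
    unfolding levi_civita_symbol_def p_def[symmetric] by (simp add: Let_def)
qed

lemma levi_civita_symbol_4:
  "levi_civita_symbol 1 2 3 4 = 1" "levi_civita_symbol 1 2 4 3 = -1"
  "levi_civita_symbol 1 3 2 4 = -1" "levi_civita_symbol 1 3 4 2 = 1"
  "levi_civita_symbol 1 4 2 3 = 1" "levi_civita_symbol 1 4 3 2 = -1"
  "levi_civita_symbol 2 1 3 4 = -1" "levi_civita_symbol 2 1 4 3 = 1"
  "levi_civita_symbol 2 3 1 4 = 1" "levi_civita_symbol 2 3 4 1 = -1"
  "levi_civita_symbol 2 4 1 3 = -1" "levi_civita_symbol 2 4 3 1 = 1"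
  "levi_civita_symbol 3 1 2 4 = 1" "levi_civita_symbol 3 1 4 2 = -1"
  "levi_civita_symbol 3 2 1 4 = -1" "levi_civita_symbol 3 2 4 1 = 1"
  "levi_civita_symbol 3 4 1 2 = 1" "levi_civita_symbol 3 4 2 1 = -1"
  "levi_civita_symbol 4 1 2 3 = -1" "levi_civita_symbol 4 1 3 2 = 1"
  "levi_civita_symbol 4 2 1 3 = 1" "levi_civita_symbol 4 2 3 1 = -1"
  "levi_civita_symbol 4 3 1 2 = -1" "levi_civita_symbol 4 3 2 1 = 1"
  by (simp_all add: levi_civita_symbol_det det_4)

lemma levi_civita_symbol_eq_0:
  assumes "a = b \<or> a = c \<or> a = d \<or> b = c \<or> b = d \<or> c = d"
  shows "levi_civita_symbol a b c d = 0"
proof -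
  define p where "p = (id(1 := a, 2 := b, 3 := c, 4 := d) :: 4 \<Rightarrow> 4)"
  have "\<not> inj p"
  proof
    assume "inj p"
    then have "p i \<noteq> p j" if "i \<noteq> j" for i j using that by (auto dest: injD)
    from this[of 1 2] this[of 1 3] this[of 1 4] this[of 2 3] this[of 2 4] this[of 3 4] assms
    show False by (auto simp: p_def)
  qed
  then have "\<not> p permutes UNIV" using permutes_inj by blast
  then show ?thesis
    unfolding levi_civita_symbol_def p_def[symmetric] by (simp add: Let_def)
qed

lemma levi_civita_symbol_same [simp]:
  "levi_civita_symbol a a c d = 0" "levi_civita_symbol a b a d = 0" "levi_civita_symbol a b c a = 0"
  "levi_civita_symbol a b b d = 0" "levi_civita_symbol a b c b = 0" "levi_civita_symbol a b c c = 0"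
  by (simp_all add: levi_civita_symbol_eq_0)

text \<open>Multiplying by the 0-1 matrix selects rows \<open>A\<close>, \<open>B\<close>,
  \<open>C\<close>, \<open>D\<close> of \<open>M\<close>, so this is multiplicativity of the
  determinant. It is the transformation law of the symbol between coordinate and frame
  indices.\<close>

lemma levi_civita_symbol_contract:
  fixes M :: "4 \<Rightarrow> 4 \<Rightarrow> real"
  shows "(\<Sum>a\<in>UNIV. \<Sum>b\<in>UNIV. \<Sum>c\<in>UNIV. \<Sum>d\<in>UNIV.
      levi_civita_symbol a b c d * (M A a * M B b * M C c * M D d))
    = levi_civita_symbol A B C D * det (\<chi> i j. M i j)"
proof -
  let ?p = "id(1 := A, 2 := B, 3 := C, 4 := D) :: 4 \<Rightarrow> 4"
  have "levi_civita_symbol A B C D * det (\<chi> i j. M i j)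
      = det ((\<chi> i j. if j = ?p i then 1 else 0) ** (\<chi> i j. M i j))"
    by (simp add: det_mul levi_civita_symbol_det)
  also have "(\<chi> i j. if j = ?p i then 1 else 0) ** (\<chi> i j. M i j) = (\<chi> i j. M (?p i) j)"
    by (simp add: matrix_matrix_mult_def vec_eq_iff if_distrib[where f="\<lambda>x. x * _"] cong: if_cong)
  also have "det (\<chi> i j. M (?p i) j) = (\<Sum>a\<in>UNIV. \<Sum>b\<in>UNIV. \<Sum>c\<in>UNIV. \<Sum>d\<in>UNIV.
      levi_civita_symbol a b c d * (M A a * M B b * M C c * M D d))"
    by (simp add: det_4 sum_4 levi_civita_symbol_4)
  finally show ?thesis ..
qed

lemma levi_civita_symbol_antisym: "levi_civita_symbol A B C D = - levi_civita_symbol A B D C"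
  using exhaust_4[of A] exhaust_4[of B] exhaust_4[of C] exhaust_4[of D]
  by (elim disjE; simp add: levi_civita_symbol_4)

text \<open>Where the symbol is nonzero its indices are a permutation of 1, 2, 3, 4. Raising all its
  indices therefore amounts to dividing by the determinant of the frame metric.\<close>

lemma levi_civita_symbol_prod:
  fixes \<eta> :: "4 \<Rightarrow> real"
  shows "levi_civita_symbol A B C D * (\<eta> A * \<eta> B * (\<eta> C * \<eta> D)) = levi_civita_symbol A B C D * (\<eta> 1 * \<eta> 2 * \<eta> 3 * \<eta> 4)"
  using exhaust_4[of A] exhaust_4[of B] exhaust_4[of C] exhaust_4[of D]
  by (elim disjE; simp add: levi_civita_symbol_4)

text \<open>The epsilon-delta identity. It holds for the bare symbol, so no signature sign appears;
  that sign enters later through the product of the frame metric entries.\<close>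

lemma levi_civita_symbol_sum:
  "(\<Sum>P\<in>UNIV. \<Sum>Q\<in>UNIV. levi_civita_symbol A B P Q * levi_civita_symbol P Q C D)
    = 2 * ((if A = C \<and> B = D then 1 else 0) - (if A = D \<and> B = C then 1 else 0))"
  \<comment> \<open>Fixing \<open>A\<close> and \<open>B\<close> first collapses the double sum to
    at most two terms before \<open>C\<close> and \<open>D\<close> are split.\<close>
  by (insert exhaust_4[of A] exhaust_4[of B], elim disjE;
      (simp add: sum_4 levi_civita_symbol_4 split del: if_split)?;
      insert exhaust_4[of C] exhaust_4[of D], elim disjE; simp add: levi_civita_symbol_4)

section \<open>Curvature in a coframe\<close>

lemma sum_rotate3:
  "(\<Sum>k\<in>K. \<Sum>c\<in>C. \<Sum>d\<in>D. f k c d) = (\<Sum>c\<in>C. \<Sum>d\<in>D. \<Sum>k\<in>K. f k c d)"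
  by (subst sum.swap) (intro sum.cong refl sum.swap)

text \<open>\<open>partial\<close> is a total function and says nothing about differentiability;
  this relation carries existence and value together, so that sum and product rules compose.\<close>

definition has_partial :: "4 \<Rightarrow> (real^4 \<Rightarrow> real) \<Rightarrow> real^4 \<Rightarrow> real \<Rightarrow> bool" where
  "has_partial i f x D \<longleftrightarrow> ((\<lambda>s. f (x + s *\<^sub>R axis i 1)) has_real_derivative D) (at 0)"

lemma partial_eqI: "has_partial i f x D \<Longrightarrow> partial i f x = D"
  unfolding has_partial_def partial_def by (rule DERIV_imp_deriv)

lemma has_partial_unique: "has_partial i f x D \<Longrightarrow> has_partial i f x D' \<Longrightarrow> D = D'"
  by (metis partial_eqI)

lemma eventually_line:
  fixes x :: "real^4"
  assumes "open S" "x \<in> S"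
  shows "eventually (\<lambda>s. x + s *\<^sub>R axis i 1 \<in> S) (nhds (0::real))"
proof -
  have "open ((\<lambda>s::real. x + s *\<^sub>R axis i 1) -` S)"
    by (intro open_vimage assms continuous_intros)
  then show ?thesis
    using eventually_nhds_in_open[of _ "0::real"] assms(2) by fastforce
qed

lemma has_partial_cong_open:
  assumes "open S" "x \<in> S" "\<And>y. y \<in> S \<Longrightarrow> f y = g y"
  shows "has_partial i f x D \<longleftrightarrow> has_partial i g x D"
  unfolding has_partial_def
proof (rule DERIV_cong_ev)
  show "\<forall>\<^sub>F s in nhds 0. f (x + s *\<^sub>R axis i 1) = g (x + s *\<^sub>R axis i 1)"
    using eventually_line[OF assms(1,2), of i] by (rule eventually_mono) (simp add: assms(3))
qed auto

lemma partial_cong_open: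
  assumes "open S" "x \<in> S" "\<And>y. y \<in> S \<Longrightarrow> f y = g y"
  shows "partial i f x = partial i g x"
proof -
  have "has_partial i f x = has_partial i g x"
    using has_partial_cong_open[OF assms] by (intro ext) simp
  then show ?thesis unfolding has_partial_def[abs_def] partial_def deriv_def by metis
qed

lemma has_partial_const: "has_partial i (\<lambda>y. k) x 0"
  by (simp add: has_partial_def)

lemma has_partial_add:
  "has_partial i f x D \<Longrightarrow> has_partial i g x D' \<Longrightarrow> has_partial i (\<lambda>y. f y + g y) x (D + D')"
  unfolding has_partial_def by (rule DERIV_add)

lemma has_partial_mult:
  "has_partial i f x D \<Longrightarrow> has_partial i g x D'
    \<Longrightarrow> has_partial i (\<lambda>y. f y * g y) x (D * g x + f x * D')"
  unfolding has_partial_def by (drule (1) DERIV_mult) (simp add: algebra_simps)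

lemma has_partial_sum:
  "(\<And>k. k \<in> K \<Longrightarrow> has_partial i (f k) x (D k))
    \<Longrightarrow> has_partial i (\<lambda>y. \<Sum>k\<in>K. f k y) x (\<Sum>k\<in>K. D k)"
  unfolding has_partial_def by (rule DERIV_sum)

lemma matrix_inv_eqI:
  fixes A B :: "real^'n^'n"
  assumes "A ** B = mat 1"
  shows "matrix_inv A = B"
proof -
  have "A ** B = mat 1 \<and> B ** A = mat 1" using assms matrix_left_right_inverse by blast
  then have "matrix_inv A ** A = mat 1"
    unfolding matrix_inv_def by (rule someI2) simp
  then have "matrix_inv A = matrix_inv A ** (A ** B)" by (simp add: assms)
  also have "\<dots> = B" using \<open>matrix_inv A ** A = mat 1\<close> by (simp add: matrix_mul_assoc)
  finally show ?thesis .
qed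

text \<open>Uniqueness of the Levi-Civita connection: for symmetric, metric-compatible coefficients
  the three derivatives of \<open>g\<close> combine to twice the lowered coefficient, and the
  inverse metric raises it again.\<close>

lemma christoffel_eqI:
  fixes G :: "4 \<Rightarrow> 4 \<Rightarrow> 4 \<Rightarrow> real"
  assumes inv: "\<And>c e. (\<Sum>d\<in>UNIV. inv_metric g x $ c $ d * g x $ d $ e) = (if c = e then 1 else 0)"
    and g_sym: "\<And>a b. g x $ a $ b = g x $ b $ a"
    and G_sym: "\<And>a b c. G c a b = G c b a"
    and compat: "\<And>a b d. partial a (\<lambda>y. g y $ b $ d) x
      = (\<Sum>e\<in>UNIV. G e a b * g x $ d $ e) + (\<Sum>e\<in>UNIV. G e a d * g x $ b $ e)"
  shows "christoffel g x c a b = G c a b"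
proof -
  have "partial a (\<lambda>y. g y $ b $ d) x + partial b (\<lambda>y. g y $ a $ d) x - partial d (\<lambda>y. g y $ a $ b) x
      = 2 * (\<Sum>e\<in>UNIV. G e a b * g x $ d $ e)" for d
    unfolding compat by (simp add: G_sym[of _ b a] G_sym[of _ d])
  then have "christoffel g x c a b
      = (\<Sum>d\<in>UNIV. inv_metric g x $ c $ d * (\<Sum>e\<in>UNIV. G e a b * g x $ d $ e))"
    unfolding christoffel_def by (simp add: sum_distrib_left mult.left_commute)
  also have "\<dots> = (\<Sum>e\<in>UNIV. G e a b * (\<Sum>d\<in>UNIV. inv_metric g x $ c $ d * g x $ d $ e))"
    unfolding sum_distrib_left by (subst sum.swap) (simp add: mult_ac)
  finally show ?thesis by (simp add: inv if_distrib[where f="\<lambda>x. _ * x"] cong: if_cong)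
qed

text \<open>
  \<open>E\<close> is the coframe and \<open>e\<close> the dual frame (first index: frame, second index: coordinate), \<open>\<eta>\<close> the
  diagonal frame metric, which need not be constant. The connection forms are
  omega^A_B = \<open>\<omega> A B C\<close> E^C; in \<open>dE\<close>, \<open>ddE\<close> the derivative directions come first and are coordinate
  directions, while the first index of \<open>d\<omega>\<close> is a frame direction.
\<close>

locale coframe =
  fixes g :: metric and S :: "(real^4) set"
    and \<eta> :: "4 \<Rightarrow> real^4 \<Rightarrow> real"
    and E e :: "4 \<Rightarrow> 4 \<Rightarrow> real^4 \<Rightarrow> real"
    and dE :: "4 \<Rightarrow> 4 \<Rightarrow> 4 \<Rightarrow> real^4 \<Rightarrow> real"
    and ddE :: "4 \<Rightarrow> 4 \<Rightarrow> 4 \<Rightarrow> 4 \<Rightarrow> real^4 \<Rightarrow> real"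
    and \<omega> :: "4 \<Rightarrow> 4 \<Rightarrow> 4 \<Rightarrow> real^4 \<Rightarrow> real"
    and d\<omega> :: "4 \<Rightarrow> 4 \<Rightarrow> 4 \<Rightarrow> 4 \<Rightarrow> real^4 \<Rightarrow> real"
  assumes open_S: "open S"
    and metric: "y \<in> S \<Longrightarrow> g y $ a $ b = (\<Sum>A\<in>UNIV. \<eta> A y * (E A a y * E A b y))"
    and \<eta>_nz: "y \<in> S \<Longrightarrow> \<eta> A y \<noteq> 0"
    and dual: "y \<in> S \<Longrightarrow> (\<Sum>a\<in>UNIV. E A a y * e B a y) = (if A = B then 1 else 0)"
    and E_partial: "y \<in> S \<Longrightarrow> has_partial c (E A a) y (dE c A a y)"
    and dE_partial: "y \<in> S \<Longrightarrow> has_partial c (dE d A a) y (ddE c d A a y)"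
    and ddE_sym: "y \<in> S \<Longrightarrow> ddE c d A a y = ddE d c A a y"
    and e_partial: "y \<in> S \<Longrightarrow> \<exists>D. has_partial c (e A a) y D"
    and \<eta>_partial: "y \<in> S \<Longrightarrow> has_partial c (\<eta> A) y (\<Sum>C\<in>UNIV. E C c y * (2 * \<eta> A y * \<omega> A A C y))"
    and \<omega>_antisym: "y \<in> S \<Longrightarrow> A \<noteq> B \<Longrightarrow> \<eta> A y * \<omega> A B C y = - (\<eta> B y * \<omega> B A C y)"
    and \<omega>_partial: "y \<in> S \<Longrightarrow> has_partial c (\<omega> A B C) y (\<Sum>D\<in>UNIV. E D c y * d\<omega> D A B C y)"
    and torsion_free: "y \<in> S \<Longrightarrow> dE c A d y - dE d A c y
      = (\<Sum>C\<in>UNIV. \<Sum>D\<in>UNIV. E C c y * (E D d y * (\<omega> A C D y - \<omega> A D C y)))"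
begin

lemma dual': "y \<in> S \<Longrightarrow> (\<Sum>A\<in>UNIV. e A a y * E A b y) = (if a = b then 1 else 0)"
proof -
  assume y: "y \<in> S"
  have "(\<chi> A a. E A a y) ** (\<chi> a B. e B a y) = mat 1"
    by (simp add: vec_eq_iff matrix_matrix_mult_def mat_def dual[OF y])
  then have "(\<chi> a B. e B a y) ** (\<chi> A a. E A a y) = mat 1"
    by (simp add: matrix_left_right_inverse)
  then show ?thesis
    by (simp add: vec_eq_iff matrix_matrix_mult_def mat_def)
qed

lemma coframe_sum: "y \<in> S \<Longrightarrow> (\<Sum>a\<in>UNIV. e B a y * (\<Sum>A\<in>UNIV. E A a y * J A)) = J B"
proof -
  assume y: "y \<in> S"
  have "(\<Sum>a\<in>UNIV. e B a y * (\<Sum>A\<in>UNIV. E A a y * J A)) = (\<Sum>A\<in>UNIV. (\<Sum>a\<in>UNIV. E A a y * e B a y) * J A)"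
    unfolding sum_distrib_left sum_distrib_right by (subst sum.swap) (simp add: mult_ac)
  then show ?thesis by (simp add: dual[OF y] if_distrib[where f="\<lambda>x. x * _"] cong: if_cong)
qed

lemma frame_sum: "y \<in> S \<Longrightarrow> (\<Sum>a\<in>UNIV. E B a y * (\<Sum>A\<in>UNIV. e A a y * J A)) = J B"
proof -
  assume y: "y \<in> S"
  have "(\<Sum>a\<in>UNIV. E B a y * (\<Sum>A\<in>UNIV. e A a y * J A)) = (\<Sum>A\<in>UNIV. (\<Sum>a\<in>UNIV. E B a y * e A a y) * J A)"
    unfolding sum_distrib_left sum_distrib_right by (subst sum.swap) (simp add: mult_ac)
  then show ?thesis by (simp add: dual[OF y] if_distrib[where f="\<lambda>x. x * _"] cong: if_cong)
qed

lemma inv_metric_eq: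
  assumes y: "y \<in> S"
  shows "inv_metric g y $ a $ b = (\<Sum>A\<in>UNIV. e A a y * (e A b y / \<eta> A y))"
proof -
  let ?h = "(\<chi> a b. \<Sum>A\<in>UNIV. e A a y * (e A b y / \<eta> A y)) :: real^4^4"
  have "(\<Sum>p\<in>UNIV. g y $ a $ p * ?h $ p $ b) = (if a = b then 1 else 0)" for a b
  proof -
    have "(\<Sum>p\<in>UNIV. g y $ a $ p * ?h $ p $ b)
        = (\<Sum>p\<in>UNIV. \<Sum>A\<in>UNIV. \<eta> A y * E A a y * (E A p y * (\<Sum>B\<in>UNIV. e B p y * (e B b y / \<eta> B y))))"
      by (simp add: metric[OF y] sum_distrib_right mult_ac)
    also have "\<dots> = (\<Sum>A\<in>UNIV. \<eta> A y * E A a y * (\<Sum>p\<in>UNIV. E A p y * (\<Sum>B\<in>UNIV. e B p y * (e B b y / \<eta> B y))))"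
      by (subst sum.swap) (simp add: sum_distrib_left)
    also have "\<dots> = (\<Sum>A\<in>UNIV. e A b y * E A a y)"
      unfolding frame_sum[OF y] by (simp add: \<eta>_nz[OF y] mult.commute)
    finally show ?thesis by (simp add: dual'[OF y] eq_commute)
  qed
  then have "g y ** ?h = mat 1"
    by (simp add: vec_eq_iff matrix_matrix_mult_def mat_def)
  then have "matrix_inv (g y) = ?h"
    by (rule matrix_inv_eqI)
  then show ?thesis by (simp add: inv_metric_def)
qed

lemma inv_metric_left:
  assumes y: "y \<in> S"
  shows "(\<Sum>d\<in>UNIV. inv_metric g y $ c $ d * g y $ d $ b) = (if c = b then 1 else 0)"
proof -
  have "(\<Sum>d\<in>UNIV. inv_metric g y $ c $ d * g y $ d $ b)
      = (\<Sum>d\<in>UNIV. \<Sum>A\<in>UNIV. e A c y / \<eta> A y * (e A d y * (\<Sum>B\<in>UNIV. E B d y * (\<eta> B y * E B b y))))"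
   
  proof -
    have "g y $ d $ b = (\<Sum>B\<in>UNIV. E B d y * (\<eta> B y * E B b y))" for d
      by (simp add: metric[OF y] mult_ac)
    then show ?thesis
      unfolding inv_metric_eq[OF y] sum_distrib_right by (simp add: mult_ac)
  qed
  also have "\<dots> = (\<Sum>A\<in>UNIV. e A c y / \<eta> A y * (\<Sum>d\<in>UNIV. e A d y * (\<Sum>B\<in>UNIV. E B d y * (\<eta> B y * E B b y))))"
    by (subst sum.swap) (simp add: sum_distrib_left)
  also have "\<dots> = (\<Sum>A\<in>UNIV. e A c y * E A b y)"
    by (simp add: coframe_sum[OF y] \<eta>_nz[OF y])
  finally show ?thesis by (simp add: dual'[OF y])
qed

section \<open>The Levi-Civita connection expressed through the connection forms\<close>

definition conn :: "4 \<Rightarrow> 4 \<Rightarrow> 4 \<Rightarrow> real^4 \<Rightarrow> real" where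
  "conn c A B y = (\<Sum>C\<in>UNIV. \<omega> A B C y * E C c y)"

text \<open>The coordinate connection for which the covariant derivative of E^A is -omega^A_B E^B,
  solved for its coefficients by means of the dual frame.\<close>

definition gam :: "4 \<Rightarrow> 4 \<Rightarrow> 4 \<Rightarrow> real^4 \<Rightarrow> real" where
  "gam a c b y = (\<Sum>A\<in>UNIV. e A a y * (dE c A b y + (\<Sum>B\<in>UNIV. conn c A B y * E B b y)))"

lemma E_gam: "y \<in> S \<Longrightarrow>
  (\<Sum>a\<in>UNIV. E A a y * gam a c b y) = dE c A b y + (\<Sum>B\<in>UNIV. conn c A B y * E B b y)"
  unfolding gam_def by (rule frame_sum)

text \<open>The first structure equation, that is \<open>torsion_free\<close>, is exactly the
  symmetry of the lower indices.\<close>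

lemma gam_sym:
  assumes y: "y \<in> S" shows "gam a c b y = gam a b c y"
proof -
  have "dE c A b y + (\<Sum>B\<in>UNIV. conn c A B y * E B b y)
      = dE b A c y + (\<Sum>B\<in>UNIV. conn b A B y * E B c y)" for A
  proof -
    have 1: "(\<Sum>B\<in>UNIV. conn c A B y * E B b y) = (\<Sum>C\<in>UNIV. \<Sum>D\<in>UNIV. E C c y * (E D b y * \<omega> A D C y))"
      unfolding conn_def sum_distrib_right by (subst sum.swap) (simp add: mult_ac)
    have 2: "(\<Sum>B\<in>UNIV. conn b A B y * E B c y) = (\<Sum>C\<in>UNIV. \<Sum>D\<in>UNIV. E C c y * (E D b y * \<omega> A C D y))"
      unfolding conn_def sum_distrib_right by (simp add: mult_ac)
    show ?thesis using torsion_free[OF y, of c A b]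
      by (simp add: 1 2 right_diff_distrib sum_subtractf)
  qed
  then show ?thesis unfolding gam_def by simp
qed

lemma metric_partial:
  assumes y: "y \<in> S"
  shows "has_partial a (\<lambda>y. g y $ b $ d) y
    ((\<Sum>f\<in>UNIV. gam f a b y * g y $ d $ f) + (\<Sum>f\<in>UNIV. gam f a d y * g y $ b $ f))"
proof -
  have *: "(\<Sum>f\<in>UNIV. gam f a b y * g y $ d $ f)
      = (\<Sum>A\<in>UNIV. \<eta> A y * E A d y * (dE a A b y + (\<Sum>B\<in>UNIV. conn a A B y * E B b y)))" for b d
  proof -
    have "(\<Sum>f\<in>UNIV. gam f a b y * g y $ d $ f)
      = (\<Sum>f\<in>UNIV. \<Sum>A\<in>UNIV. \<eta> A y * E A d y * (E A f y * gam f a b y))"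
      by (simp add: metric[OF y] sum_distrib_left mult_ac)
    also have "\<dots> = (\<Sum>A\<in>UNIV. \<eta> A y * E A d y * (\<Sum>f\<in>UNIV. E A f y * gam f a b y))"
      by (subst sum.swap) (simp add: sum_distrib_left)
    finally show ?thesis by (simp add: E_gam[OF y])
  qed
  \<comment> \<open>Off the diagonal the lowered connection is antisymmetric and drops out; its
    diagonal reproduces the derivative of the nonconstant \<open>\<eta>\<close>.\<close>
  have lower: "\<eta> A y * conn a A B y + \<eta> B y * conn a B A y
      = (if A = B then \<Sum>C\<in>UNIV. E C a y * (2 * \<eta> A y * \<omega> A A C y) else 0)" for A B
  proof (cases "A = B")
    case True
    then show ?thesis by (simp add: conn_def sum_distrib_left mult_ac)
  next
    case False
    have "\<eta> A y * \<omega> A B C y * E C a y + \<eta> B y * \<omega> B A C y * E C a y = 0" for C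
      using \<omega>_antisym[OF y False, of C] by simp
    then show ?thesis using False
      by (simp add: conn_def sum_distrib_left mult.assoc[symmetric] flip: sum.distrib)
  qed
  have "(\<Sum>A\<in>UNIV. \<eta> A y * E A d y * (\<Sum>B\<in>UNIV. conn a A B y * E B b y))
      + (\<Sum>A\<in>UNIV. \<eta> A y * E A b y * (\<Sum>B\<in>UNIV. conn a A B y * E B d y))
      = (\<Sum>A\<in>UNIV. \<Sum>B\<in>UNIV. (E A d y * E B b y) * (\<eta> A y * conn a A B y))
        + (\<Sum>B\<in>UNIV. \<Sum>A\<in>UNIV. (E A d y * E B b y) * (\<eta> B y * conn a B A y))"
    by (simp add: sum_distrib_left mult_ac)
  also have "\<dots> = (\<Sum>A\<in>UNIV. \<Sum>B\<in>UNIV. (E A d y * E B b y) * (\<eta> A y * conn a A B y + \<eta> B y * conn a B A y))"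
    by (subst sum.swap[of "\<lambda>B A. E A d y * E B b y * (\<eta> B y * conn a B A y)"]) (simp add: distrib_left sum.distrib)
  also have "\<dots> = (\<Sum>A\<in>UNIV. (E A d y * E A b y) * (\<Sum>C\<in>UNIV. E C a y * (2 * \<eta> A y * \<omega> A A C y)))"
    unfolding lower by (simp add: if_distrib[where f="\<lambda>x. _ * x"] cong: if_cong)
  finally have diag: "(\<Sum>A\<in>UNIV. \<eta> A y * E A d y * (\<Sum>B\<in>UNIV. conn a A B y * E B b y))
      + (\<Sum>A\<in>UNIV. \<eta> A y * E A b y * (\<Sum>B\<in>UNIV. conn a A B y * E B d y)) = \<dots>" .
  have "has_partial a (\<lambda>y. g y $ b $ d) y
     (\<Sum>A\<in>UNIV. (\<Sum>C\<in>UNIV. E C a y * (2 * \<eta> A y * \<omega> A A C y)) * (E A b y * E A d y)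
       + \<eta> A y * (dE a A b y * E A d y + E A b y * dE a A d y))"
    by (subst has_partial_cong_open[OF open_S y metric], assumption)
      (intro has_partial_sum has_partial_mult \<eta>_partial E_partial y)
  moreover have "(\<Sum>A\<in>UNIV. (\<Sum>C\<in>UNIV. E C a y * (2 * \<eta> A y * \<omega> A A C y)) * (E A b y * E A d y)
       + \<eta> A y * (dE a A b y * E A d y + E A b y * dE a A d y))
     = (\<Sum>f\<in>UNIV. gam f a b y * g y $ d $ f) + (\<Sum>f\<in>UNIV. gam f a d y * g y $ b $ f)"
    unfolding * distrib_left[of _ "dE _ _ _ _"] sum.distrib
    using diag by (simp add: algebra_simps sum.distrib)
  ultimately show ?thesis by simp
qed

lemma christoffel_eq: "y \<in> S \<Longrightarrow> christoffel g y c a b = gam c a b y"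
proof (rule christoffel_eqI)
  assume y: "y \<in> S"
  show "g y $ a $ b = g y $ b $ a" for a b by (simp add: metric[OF y] mult_ac)
qed (simp_all add: inv_metric_left gam_sym partial_eqI[OF metric_partial])

section \<open>Cartan's second structure equation and the Riemann tensor\<close>

definition frame_curvature :: "4 \<Rightarrow> 4 \<Rightarrow> 4 \<Rightarrow> 4 \<Rightarrow> real^4 \<Rightarrow> real" where
  "frame_curvature A B C D y = d\<omega> C A B D y - d\<omega> D A B C y
     + (\<Sum>K\<in>UNIV. \<omega> A K C y * \<omega> K B D y - \<omega> A K D y * \<omega> K B C y)
     + (\<Sum>K\<in>UNIV. \<omega> A B K y * (\<omega> K C D y - \<omega> K D C y))"

definition curvature_form :: "4 \<Rightarrow> 4 \<Rightarrow> 4 \<Rightarrow> 4 \<Rightarrow> real^4 \<Rightarrow> real" where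
  "curvature_form A B c d y = (\<Sum>C\<in>UNIV. \<Sum>D\<in>UNIV. E C c y * (E D d y * frame_curvature A B C D y))"

definition dconn :: "4 \<Rightarrow> 4 \<Rightarrow> 4 \<Rightarrow> 4 \<Rightarrow> real^4 \<Rightarrow> real" where
  "dconn c d A B y = (\<Sum>C\<in>UNIV. (\<Sum>D\<in>UNIV. E D c y * d\<omega> D A B C y) * E C d y + \<omega> A B C y * dE c C d y)"

lemma conn_partial: "y \<in> S \<Longrightarrow> has_partial c (conn d A B) y (dconn c d A B y)"
  unfolding conn_def[abs_def] dconn_def
  by (rule has_partial_sum, rule has_partial_mult[OF \<omega>_partial E_partial])

text \<open>Coordinate components of d omega + omega wedge omega. Differentiating omega =
  \<open>\<omega> A B K\<close> E^K also produces dE^K; \<open>torsion_free\<close> trades it for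
  connection coefficients, which is the origin of the last sum in
  \<open>frame_curvature\<close>.\<close>

lemma conn_curvature:
  assumes y: "y \<in> S"
  shows "dconn c d A B y - dconn d c A B y
     + ((\<Sum>K\<in>UNIV. conn c A K y * conn d K B y) - (\<Sum>K\<in>UNIV. conn d A K y * conn c K B y))
     = curvature_form A B c d y"
proof -
  have quad: "(\<Sum>K\<in>UNIV. conn c A K y * conn d K B y)
      = (\<Sum>C\<in>UNIV. \<Sum>D\<in>UNIV. E C c y * (E D d y * (\<Sum>K\<in>UNIV. \<omega> A K C y * \<omega> K B D y)))" for c d
    unfolding conn_def sum_product by (subst sum_rotate3) (simp add: sum_distrib_left mult_ac)
  have quad': "(\<Sum>K\<in>UNIV. conn d A K y * conn c K B y)
      = (\<Sum>C\<in>UNIV. \<Sum>D\<in>UNIV. E C c y * (E D d y * (\<Sum>K\<in>UNIV. \<omega> A K D y * \<omega> K B C y)))" for c d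
    unfolding quad by (subst sum.swap) (simp add: mult_ac)
  have lin: "(\<Sum>C\<in>UNIV. (\<Sum>D\<in>UNIV. E D c y * d\<omega> D A B C y) * E C d y)
      = (\<Sum>C\<in>UNIV. \<Sum>D\<in>UNIV. E C c y * (E D d y * d\<omega> C A B D y))" for c d
    unfolding sum_distrib_right by (subst sum.swap) (simp add: mult_ac)
  have lin': "(\<Sum>C\<in>UNIV. (\<Sum>D\<in>UNIV. E D d y * d\<omega> D A B C y) * E C c y)
      = (\<Sum>C\<in>UNIV. \<Sum>D\<in>UNIV. E C c y * (E D d y * d\<omega> D A B C y))" for c d
    unfolding sum_distrib_right by (simp add: mult_ac)
  have "(\<Sum>K\<in>UNIV. \<omega> A B K y * dE c K d y) - (\<Sum>K\<in>UNIV. \<omega> A B K y * dE d K c y)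
      = (\<Sum>K\<in>UNIV. \<omega> A B K y * (dE c K d y - dE d K c y))"
    by (simp add: right_diff_distrib sum_subtractf)
  also have "\<dots> = (\<Sum>C\<in>UNIV. \<Sum>D\<in>UNIV. E C c y * (E D d y * (\<Sum>K\<in>UNIV. \<omega> A B K y * (\<omega> K C D y - \<omega> K D C y))))"
    unfolding torsion_free[OF y] sum_distrib_left by (subst sum_rotate3) (simp add: mult_ac)
  finally have tors: "(\<Sum>K\<in>UNIV. \<omega> A B K y * dE c K d y) - (\<Sum>K\<in>UNIV. \<omega> A B K y * dE d K c y) = \<dots>" .
  have "curvature_form A B c d y =
      (\<Sum>C\<in>UNIV. \<Sum>D\<in>UNIV. E C c y * (E D d y * d\<omega> C A B D y))
      - (\<Sum>C\<in>UNIV. \<Sum>D\<in>UNIV. E C c y * (E D d y * d\<omega> D A B C y))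
      + ((\<Sum>C\<in>UNIV. \<Sum>D\<in>UNIV. E C c y * (E D d y * (\<Sum>K\<in>UNIV. \<omega> A K C y * \<omega> K B D y)))
         - (\<Sum>C\<in>UNIV. \<Sum>D\<in>UNIV. E C c y * (E D d y * (\<Sum>K\<in>UNIV. \<omega> A K D y * \<omega> K B C y))))
      + (\<Sum>C\<in>UNIV. \<Sum>D\<in>UNIV. E C c y * (E D d y * (\<Sum>K\<in>UNIV. \<omega> A B K y * (\<omega> K C D y - \<omega> K D C y))))"
    unfolding curvature_form_def frame_curvature_def sum_subtractf distrib_left right_diff_distrib sum.distrib
    by simp
  then show ?thesis
    unfolding dconn_def sum.distrib lin[of c d] lin'[of d c] using quad[of c d] quad'[of d c] tors by linarith
qed

text \<open>Only differentiability is extracted here. The derivative itself is pinned down in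
  \<open>E_gam_partial\<close> by differentiating the identity \<open>E_gam\<close>, so the
  derivatives of the dual frame need no formula.\<close>

lemma gam_partial: "y \<in> S \<Longrightarrow> has_partial c (gam a d b) y (partial c (gam a d b) y)"
proof -
  assume y: "y \<in> S"
  obtain De where De: "\<And>A a. has_partial c (e A a) y (De A a)"
    using e_partial[OF y] by metis
  have *: "has_partial c (gam a d b) y
     (\<Sum>A\<in>UNIV. De A a * (dE d A b y + (\<Sum>B\<in>UNIV. conn d A B y * E B b y))
       + e A a y * (ddE c d A b y + (\<Sum>B\<in>UNIV. dconn c d A B y * E B b y + conn d A B y * dE c B b y)))"
    unfolding gam_def[abs_def]
    by (rule has_partial_sum, rule has_partial_mult[OF De], rule has_partial_add[OF dE_partial[OF y]],
      rule has_partial_sum, rule has_partial_mult[OF conn_partial[OF y] E_partial[OF y]])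
  show ?thesis unfolding partial_eqI[OF *] by (rule *)
qed

lemma E_gam_partial:
  assumes y: "y \<in> S"
  shows "(\<Sum>a\<in>UNIV. dE c A a y * gam a d b y) + (\<Sum>a\<in>UNIV. E A a y * partial c (gam a d b) y)
    = ddE c d A b y + (\<Sum>B\<in>UNIV. dconn c d A B y * E B b y) + (\<Sum>B\<in>UNIV. conn d A B y * dE c B b y)"
proof -
  have "has_partial c (\<lambda>y. \<Sum>a\<in>UNIV. E A a y * gam a d b y) y
      (\<Sum>a\<in>UNIV. dE c A a y * gam a d b y + E A a y * partial c (gam a d b) y)"
    by (rule has_partial_sum, rule has_partial_mult[OF E_partial[OF y] gam_partial[OF y]])
  moreover have "has_partial c (\<lambda>y. \<Sum>a\<in>UNIV. E A a y * gam a d b y) y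
      (ddE c d A b y + (\<Sum>B\<in>UNIV. dconn c d A B y * E B b y + conn d A B y * dE c B b y))"
    by (subst has_partial_cong_open[OF open_S y E_gam], assumption)
      (rule has_partial_add[OF dE_partial[OF y]], rule has_partial_sum,
       rule has_partial_mult[OF conn_partial[OF y] E_partial[OF y]])
  ultimately have "(\<Sum>a\<in>UNIV. dE c A a y * gam a d b y + E A a y * partial c (gam a d b) y)
      = ddE c d A b y + (\<Sum>B\<in>UNIV. dconn c d A B y * E B b y + conn d A B y * dE c B b y)"
    by (rule has_partial_unique)
  then show ?thesis unfolding sum.distrib by (simp only: add.assoc)
qed

lemma E_gam_gam:
  assumes y: "y \<in> S"
  shows "(\<Sum>a\<in>UNIV. E A a y * (\<Sum>f\<in>UNIV. gam a c f y * gam f d b y))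
    = (\<Sum>f\<in>UNIV. dE c A f y * gam f d b y) + (\<Sum>B\<in>UNIV. conn c A B y * dE d B b y)
      + (\<Sum>B\<in>UNIV. (\<Sum>K\<in>UNIV. conn c A K y * conn d K B y) * E B b y)"
proof -
  have "(\<Sum>a\<in>UNIV. E A a y * (\<Sum>f\<in>UNIV. gam a c f y * gam f d b y))
      = (\<Sum>f\<in>UNIV. (\<Sum>a\<in>UNIV. E A a y * gam a c f y) * gam f d b y)"
    unfolding sum_distrib_left sum_distrib_right by (subst sum.swap) (simp add: mult_ac)
  also have "\<dots> = (\<Sum>f\<in>UNIV. dE c A f y * gam f d b y)
      + (\<Sum>f\<in>UNIV. (\<Sum>B\<in>UNIV. conn c A B y * E B f y) * gam f d b y)"
    by (simp add: E_gam[OF y] distrib_right sum.distrib)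
  also have "(\<Sum>f\<in>UNIV. (\<Sum>B\<in>UNIV. conn c A B y * E B f y) * gam f d b y)
      = (\<Sum>B\<in>UNIV. conn c A B y * (\<Sum>f\<in>UNIV. E B f y * gam f d b y))"
    unfolding sum_distrib_left sum_distrib_right by (subst sum.swap) (simp add: mult_ac)
  also have "\<dots> = (\<Sum>B\<in>UNIV. conn c A B y * dE d B b y)
      + (\<Sum>K\<in>UNIV. \<Sum>B\<in>UNIV. conn c A K y * conn d K B y * E B b y)"
    by (simp add: E_gam[OF y] distrib_left sum.distrib sum_distrib_left mult_ac)
  also have "(\<Sum>K\<in>UNIV. \<Sum>B\<in>UNIV. conn c A K y * conn d K B y * E B b y)
      = (\<Sum>B\<in>UNIV. (\<Sum>K\<in>UNIV. conn c A K y * conn d K B y) * E B b y)"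
    by (subst sum.swap) (simp add: sum_distrib_right)
  finally show ?thesis by simp
qed

lemma E_riemann_up:
  assumes y: "y \<in> S"
  shows "(\<Sum>a\<in>UNIV. E A a y * riemann_up g y a b c d) = (\<Sum>B\<in>UNIV. E B b y * curvature_form A B c d y)"
proof -
  have "partial c (\<lambda>z. christoffel g z a d b) y = partial c (gam a d b) y" for a c d
    by (rule partial_cong_open[OF open_S y]) (rule christoffel_eq)
  then have R: "riemann_up g y a b c d = partial c (gam a d b) y - partial d (gam a c b) y
      + ((\<Sum>f\<in>UNIV. gam a c f y * gam f d b y) - (\<Sum>f\<in>UNIV. gam a d f y * gam f c b y))" for a
    unfolding riemann_up_def by (simp add: christoffel_eq[OF y] sum_subtractf)
  have "(\<Sum>a\<in>UNIV. E A a y * riemann_up g y a b c d)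
     = (\<Sum>a\<in>UNIV. E A a y * partial c (gam a d b) y) - (\<Sum>a\<in>UNIV. E A a y * partial d (gam a c b) y)
      + ((\<Sum>a\<in>UNIV. E A a y * (\<Sum>f\<in>UNIV. gam a c f y * gam f d b y))
       - (\<Sum>a\<in>UNIV. E A a y * (\<Sum>f\<in>UNIV. gam a d f y * gam f c b y)))"
    unfolding R distrib_left right_diff_distrib sum.distrib sum_subtractf ..
  \<comment> \<open>After antisymmetrisation in \<open>c\<close>, \<open>d\<close> the terms
    \<open>dE\<close> times \<open>gam\<close> and \<open>conn\<close> times \<open>dE\<close>
    cancel between \<open>E_gam_partial\<close> and \<open>E_gam_gam\<close>, and the second
    derivatives cancel by \<open>ddE_sym\<close>.\<close>
  also have "\<dots> = (\<Sum>B\<in>UNIV. dconn c d A B y * E B b y) - (\<Sum>B\<in>UNIV. dconn d c A B y * E B b y)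
      + ((\<Sum>B\<in>UNIV. (\<Sum>K\<in>UNIV. conn c A K y * conn d K B y) * E B b y)
        - (\<Sum>B\<in>UNIV. (\<Sum>K\<in>UNIV. conn d A K y * conn c K B y) * E B b y))"
    using E_gam_partial[OF y, of c A d b] E_gam_partial[OF y, of d A c b] ddE_sym[OF y, of c d A b]
      E_gam_gam[OF y, of A c d b] E_gam_gam[OF y, of A d c b] by linarith
  also have "\<dots> = (\<Sum>B\<in>UNIV. E B b y * curvature_form A B c d y)"
    unfolding conn_curvature[OF y, symmetric] distrib_left right_diff_distrib sum.distrib sum_subtractf
    by (simp add: mult.commute)
  finally show ?thesis .
qed

lemma riemann_up_eq:
  assumes y: "y \<in> S"
  shows "riemann_up g y a b c d = (\<Sum>A\<in>UNIV. e A a y * (\<Sum>B\<in>UNIV. E B b y * curvature_form A B c d y))"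
proof -
  have "(\<Sum>A\<in>UNIV. e A a y * (\<Sum>f\<in>UNIV. E A f y * riemann_up g y f b c d))
      = (\<Sum>f\<in>UNIV. (\<Sum>A\<in>UNIV. e A a y * E A f y) * riemann_up g y f b c d)"
    unfolding sum_distrib_left sum_distrib_right by (subst sum.swap) (simp add: mult_ac)
  also have "\<dots> = riemann_up g y a b c d"
    unfolding dual'[OF y] by (simp add: if_distrib[where f="\<lambda>x. x * _"] cong: if_cong)
  finally show ?thesis unfolding E_riemann_up[OF y] by (rule sym)
qed

definition frame_riemann :: "4 \<Rightarrow> 4 \<Rightarrow> 4 \<Rightarrow> 4 \<Rightarrow> real^4 \<Rightarrow> real" where
  "frame_riemann A B C D y = \<eta> A y * frame_curvature A B C D y"

lemma riemann_eq:
  assumes y: "y \<in> S"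
  shows "riemann g y a b c d = (\<Sum>A\<in>UNIV. E A a y * (\<Sum>B\<in>UNIV. E B b y *
    (\<Sum>C\<in>UNIV. E C c y * (\<Sum>D\<in>UNIV. E D d y * frame_riemann A B C D y))))"
proof -
  have "riemann g y a b c d
      = (\<Sum>f\<in>UNIV. \<Sum>A\<in>UNIV. E A a y * \<eta> A y * (E A f y * riemann_up g y f b c d))"
    unfolding riemann_def metric[OF y] sum_distrib_right by (simp add: mult_ac)
  also have "\<dots> = (\<Sum>A\<in>UNIV. E A a y * \<eta> A y * (\<Sum>f\<in>UNIV. E A f y * riemann_up g y f b c d))"
    by (subst sum.swap) (simp add: sum_distrib_left)
  also have "\<dots> = (\<Sum>A\<in>UNIV. E A a y * (\<Sum>B\<in>UNIV. E B b y * (\<eta> A y * curvature_form A B c d y)))"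
    unfolding E_riemann_up[OF y] by (simp add: sum_distrib_left mult_ac)
  finally show ?thesis
    unfolding curvature_form_def frame_riemann_def by (simp add: sum_distrib_left mult_ac)
qed

lemma ricci_eq_0:
  assumes y: "y \<in> S"
    and flat: "\<And>B D. (\<Sum>A\<in>UNIV. frame_curvature A B A D y) = 0"
  shows "ricci g y b d = 0"
proof -
  have "riemann_up g y a b c d = (\<Sum>A\<in>UNIV. e A a y *
      (\<Sum>C\<in>UNIV. E C c y * (\<Sum>B\<in>UNIV. \<Sum>D\<in>UNIV. E B b y * (E D d y * frame_curvature A B C D y))))" for a c
  proof -
    have "(\<Sum>B\<in>UNIV. E B b y * curvature_form A B c d y)
        = (\<Sum>C\<in>UNIV. E C c y * (\<Sum>B\<in>UNIV. \<Sum>D\<in>UNIV. E B b y * (E D d y * frame_curvature A B C D y)))" for A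
      unfolding curvature_form_def sum_distrib_left by (subst sum.swap) (simp add: mult_ac)
    then show ?thesis by (simp add: riemann_up_eq[OF y])
  qed
  then have "ricci g y b d = (\<Sum>A\<in>UNIV. \<Sum>a\<in>UNIV. e A a y *
      (\<Sum>C\<in>UNIV. E C a y * (\<Sum>B\<in>UNIV. \<Sum>D\<in>UNIV. E B b y * (E D d y * frame_curvature A B C D y))))"
    unfolding ricci_def by (subst sum.swap) simp
  also have "\<dots> = (\<Sum>B\<in>UNIV. \<Sum>D\<in>UNIV. \<Sum>A\<in>UNIV. E B b y * (E D d y * frame_curvature A B A D y))"
    unfolding coframe_sum[OF y] by (rule sum_rotate3)
  finally show ?thesis by (simp add: flat flip: sum_distrib_left)
qed

lemma weyl_eq_riemann:
  assumes "\<And>b d. ricci g y b d = 0"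
  shows "weyl g y a b c d = riemann g y a b c d"
  by (simp add: weyl_def scalar_curvature_def assms)

subsection \<open>Ricci-flat metrics: the quadratic invariants in the coframe\<close>

text \<open>The frame metric is diagonal, so raising an index turns coframe into frame and divides
  by one entry of \<open>\<eta>\<close>.\<close>

lemma raise_slot:
  assumes y: "y \<in> S"
  shows "(\<Sum>p\<in>UNIV. inv_metric g y $ a $ p * (\<Sum>A\<in>UNIV. E A p y * J A))
    = (\<Sum>A\<in>UNIV. e A a y * (J A / \<eta> A y))"
proof -
  have "(\<Sum>p\<in>UNIV. inv_metric g y $ a $ p * (\<Sum>A\<in>UNIV. E A p y * J A))
      = (\<Sum>p\<in>UNIV. \<Sum>B\<in>UNIV. e B a y / \<eta> B y * (e B p y * (\<Sum>A\<in>UNIV. E A p y * J A)))"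
    unfolding inv_metric_eq[OF y] sum_distrib_right by (simp add: mult_ac)
  also have "\<dots> = (\<Sum>B\<in>UNIV. e B a y / \<eta> B y * (\<Sum>p\<in>UNIV. e B p y * (\<Sum>A\<in>UNIV. E A p y * J A)))"
    by (subst sum.swap) (simp add: sum_distrib_left)
  finally show ?thesis unfolding coframe_sum[OF y] by simp
qed

lemma raise_two_slots:
  assumes y: "y \<in> S"
  shows "(\<Sum>p\<in>UNIV. \<Sum>q\<in>UNIV. inv_metric g y $ a $ p * inv_metric g y $ b $ q *
      (\<Sum>A\<in>UNIV. E A p y * (\<Sum>B\<in>UNIV. E B q y * J A B)))
    = (\<Sum>A\<in>UNIV. e A a y * (\<Sum>B\<in>UNIV. e B b y * (J A B / (\<eta> A y * \<eta> B y))))"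
proof -
  have "(\<Sum>q\<in>UNIV. inv_metric g y $ b $ q * (\<Sum>A\<in>UNIV. E A p y * (\<Sum>B\<in>UNIV. E B q y * J A B)))
      = (\<Sum>A\<in>UNIV. E A p y * (\<Sum>B\<in>UNIV. e B b y * (J A B / \<eta> B y)))" for p
    unfolding raise_slot[OF y, symmetric] sum_distrib_left[of _ "\<lambda>A. E A p y * _ A"]
    by (subst sum.swap) (simp add: sum_distrib_left mult_ac)
  then have "(\<Sum>p\<in>UNIV. \<Sum>q\<in>UNIV. inv_metric g y $ a $ p * inv_metric g y $ b $ q *
      (\<Sum>A\<in>UNIV. E A p y * (\<Sum>B\<in>UNIV. E B q y * J A B)))
    = (\<Sum>p\<in>UNIV. inv_metric g y $ a $ p * (\<Sum>A\<in>UNIV. E A p y * (\<Sum>B\<in>UNIV. e B b y * (J A B / \<eta> B y))))"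
    by (simp add: mult.assoc flip: sum_distrib_left)
  then show ?thesis
    unfolding raise_slot[OF y] by (simp add: sum_divide_distrib mult_ac)
qed

lemma contract_slot:
  assumes y: "y \<in> S"
  shows "(\<Sum>a\<in>UNIV. (\<Sum>A\<in>UNIV. E A a y * J A) * (\<Sum>A\<in>UNIV. e A a y * L A)) = (\<Sum>A\<in>UNIV. J A * L A)"
proof -
  have "(\<Sum>a\<in>UNIV. (\<Sum>A\<in>UNIV. E A a y * J A) * (\<Sum>A\<in>UNIV. e A a y * L A))
      = (\<Sum>B\<in>UNIV. L B * (\<Sum>a\<in>UNIV. e B a y * (\<Sum>A\<in>UNIV. E A a y * J A)))"
    unfolding sum_distrib_left[of _ "\<lambda>A. e A _ y * L A"] sum_distrib_left[of "L _"]
    by (subst sum.swap) (simp add: mult_ac)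
  then show ?thesis unfolding coframe_sum[OF y] by (simp add: mult.commute)
qed

lemma contract_two_slots:
  assumes y: "y \<in> S"
  shows "(\<Sum>a\<in>UNIV. \<Sum>b\<in>UNIV.
      (\<Sum>A\<in>UNIV. E A a y * (\<Sum>B\<in>UNIV. E B b y * J A B)) * (\<Sum>A\<in>UNIV. e A a y * (\<Sum>B\<in>UNIV. e B b y * L A B)))
    = (\<Sum>A\<in>UNIV. \<Sum>B\<in>UNIV. J A B * L A B)"
proof -
  have "(\<Sum>a\<in>UNIV. \<Sum>b\<in>UNIV.
      (\<Sum>A\<in>UNIV. E A a y * (\<Sum>B\<in>UNIV. E B b y * J A B)) * (\<Sum>A\<in>UNIV. e A a y * (\<Sum>B\<in>UNIV. e B b y * L A B)))
    = (\<Sum>b\<in>UNIV. \<Sum>A\<in>UNIV. (\<Sum>B\<in>UNIV. E B b y * J A B) * (\<Sum>B\<in>UNIV. e B b y * L A B))"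
    by (subst sum.swap) (simp only: contract_slot[OF y])
  also have "\<dots> = (\<Sum>A\<in>UNIV. \<Sum>B\<in>UNIV. J A B * L A B)"
    by (subst sum.swap) (simp only: contract_slot[OF y])
  finally show ?thesis .
qed

text \<open>Two applications of the two-slot contraction, with the double sums interchanged in
  between so that the active pair is always innermost.\<close>

lemma contract_four_slots:
  assumes y: "y \<in> S"
  shows "(\<Sum>a\<in>UNIV. \<Sum>b\<in>UNIV. \<Sum>c\<in>UNIV. \<Sum>d\<in>UNIV.
      (\<Sum>A\<in>UNIV. E A a y * (\<Sum>B\<in>UNIV. E B b y * (\<Sum>C\<in>UNIV. E C c y * (\<Sum>D\<in>UNIV. E D d y * J A B C D))))
      * (\<Sum>A\<in>UNIV. e A a y * (\<Sum>B\<in>UNIV. e B b y * (\<Sum>C\<in>UNIV. e C c y * (\<Sum>D\<in>UNIV. e D d y * L A B C D)))))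
    = (\<Sum>A\<in>UNIV. \<Sum>B\<in>UNIV. \<Sum>C\<in>UNIV. \<Sum>D\<in>UNIV. J A B C D * L A B C D)"
    (is "(\<Sum>a\<in>_. \<Sum>b\<in>_. \<Sum>c\<in>_. \<Sum>d\<in>_. ?f a b c d) = _")
proof -
  have "(\<Sum>a\<in>UNIV. \<Sum>b\<in>UNIV. \<Sum>c\<in>UNIV. \<Sum>d\<in>UNIV. ?f a b c d)
      = (\<Sum>c\<in>UNIV. \<Sum>d\<in>UNIV. \<Sum>a\<in>UNIV. \<Sum>b\<in>UNIV. ?f a b c d)"
    by (subst sum_rotate3[symmetric]) (intro sum.cong refl sum_rotate3)
  also have "\<dots> = (\<Sum>c\<in>UNIV. \<Sum>d\<in>UNIV. \<Sum>A\<in>UNIV. \<Sum>B\<in>UNIV.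
      (\<Sum>C\<in>UNIV. E C c y * (\<Sum>D\<in>UNIV. E D d y * J A B C D))
      * (\<Sum>C\<in>UNIV. e C c y * (\<Sum>D\<in>UNIV. e D d y * L A B C D)))"
    by (simp only: contract_two_slots[OF y])
  also have "\<dots> = (\<Sum>A\<in>UNIV. \<Sum>B\<in>UNIV. \<Sum>c\<in>UNIV. \<Sum>d\<in>UNIV.
      (\<Sum>C\<in>UNIV. E C c y * (\<Sum>D\<in>UNIV. E D d y * J A B C D))
      * (\<Sum>C\<in>UNIV. e C c y * (\<Sum>D\<in>UNIV. e D d y * L A B C D)))"
    by (subst sum_rotate3[symmetric]) (intro sum.cong refl sum_rotate3)
  finally show ?thesis by (simp only: contract_two_slots[OF y])
qed

definition frame_raised :: "4 \<Rightarrow> 4 \<Rightarrow> 4 \<Rightarrow> 4 \<Rightarrow> real^4 \<Rightarrow> real" where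
  "frame_raised A B C D y = frame_riemann A B C D y / (\<eta> A y * \<eta> B y)"

definition frame_raised_all :: "4 \<Rightarrow> 4 \<Rightarrow> 4 \<Rightarrow> 4 \<Rightarrow> real^4 \<Rightarrow> real" where
  "frame_raised_all A B C D y = frame_riemann A B C D y / (\<eta> A y * \<eta> B y) / (\<eta> C y * \<eta> D y)"

text \<open>The factors 1/2 and sqrt |det g| of \<open>dual_weyl\<close> are left out here and
  reappear in \<open>dual_weyl_eq\<close>.\<close>

definition frame_dual :: "4 \<Rightarrow> 4 \<Rightarrow> 4 \<Rightarrow> 4 \<Rightarrow> real^4 \<Rightarrow> real" where
  "frame_dual A B C D y = (\<Sum>P\<in>UNIV. \<Sum>Q\<in>UNIV. levi_civita_symbol A B P Q * frame_raised P Q C D y)"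

text \<open>Raising acts on the outermost pair of slots; this brings the second pair to that
  position and back.\<close>

lemma swap_blocks:
  "(\<Sum>A\<in>UNIV. e' A * (\<Sum>B\<in>UNIV. f' B * (\<Sum>C\<in>UNIV. h C * (\<Sum>D\<in>UNIV. k D * J A B C D))))
    = (\<Sum>C\<in>UNIV. h C * (\<Sum>D\<in>UNIV. k D * (\<Sum>A\<in>UNIV. e' A * (\<Sum>B\<in>UNIV. f' B * J A B C D))))"
  for J :: "4 \<Rightarrow> 4 \<Rightarrow> 4 \<Rightarrow> 4 \<Rightarrow> real"
proof -
  have "(\<Sum>A\<in>UNIV. e' A * (\<Sum>B\<in>UNIV. f' B * (\<Sum>C\<in>UNIV. h C * (\<Sum>D\<in>UNIV. k D * J A B C D))))
      = (\<Sum>A\<in>UNIV. \<Sum>B\<in>UNIV. \<Sum>C\<in>UNIV. \<Sum>D\<in>UNIV. e' A * f' B * h C * k D * J A B C D)"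
    by (simp add: sum_distrib_left mult.assoc)
  also have "\<dots> = (\<Sum>C\<in>UNIV. \<Sum>D\<in>UNIV. \<Sum>A\<in>UNIV. \<Sum>B\<in>UNIV. e' A * f' B * h C * k D * J A B C D)"
    by (subst sum_rotate3[symmetric]) (intro sum.cong refl sum_rotate3)
  finally show ?thesis by (simp add: sum_distrib_left mult_ac)
qed

context
  fixes y :: "real^4"
  assumes y: "y \<in> S"
    and flat: "\<And>B D. (\<Sum>A\<in>UNIV. frame_curvature A B A D y) = 0"
begin

lemma weyl_eq: "weyl g y a b c d = (\<Sum>A\<in>UNIV. E A a y * (\<Sum>B\<in>UNIV. E B b y *
    (\<Sum>C\<in>UNIV. E C c y * (\<Sum>D\<in>UNIV. E D d y * frame_riemann A B C D y))))"
  by (simp only: weyl_eq_riemann[OF ricci_eq_0[OF y flat]] riemann_eq[OF y])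

lemma raise_first_eq: "raise_first g (weyl g) y a b c d = (\<Sum>A\<in>UNIV. e A a y * (\<Sum>B\<in>UNIV. e B b y *
    (\<Sum>C\<in>UNIV. E C c y * (\<Sum>D\<in>UNIV. E D d y * frame_raised A B C D y))))"
  unfolding raise_first_def weyl_eq raise_two_slots[OF y]
  by (simp only: frame_raised_def sum_divide_distrib times_divide_eq_right[symmetric])

lemma raise_first_eq': "raise_first g (weyl g) y a b c d = (\<Sum>C\<in>UNIV. E C c y * (\<Sum>D\<in>UNIV. E D d y *
    (\<Sum>A\<in>UNIV. e A a y * (\<Sum>B\<in>UNIV. e B b y * frame_raised A B C D y))))"
  unfolding raise_first_eq by (rule swap_blocks)

lemma raise_all_eq: "raise_all g (weyl g) y a b c d = (\<Sum>A\<in>UNIV. e A a y * (\<Sum>B\<in>UNIV. e B b y *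
    (\<Sum>C\<in>UNIV. e C c y * (\<Sum>D\<in>UNIV. e D d y * frame_raised_all A B C D y))))"
proof -
  have "raise_all g (weyl g) y a b c d = (\<Sum>C\<in>UNIV. e C c y * (\<Sum>D\<in>UNIV. e D d y *
    (\<Sum>A\<in>UNIV. e A a y * (\<Sum>B\<in>UNIV. e B b y * frame_raised_all A B C D y))))"
    unfolding raise_all_def raise_first_eq' raise_two_slots[OF y]
    by (simp only: frame_raised_all_def frame_raised_def sum_divide_distrib times_divide_eq_right[symmetric])
  then show ?thesis by (rule trans) (rule swap_blocks)
qed

lemma inv_I1_eq: "inv_I1 g y = (\<Sum>A\<in>UNIV. \<Sum>B\<in>UNIV. \<Sum>C\<in>UNIV. \<Sum>D\<in>UNIV.
    frame_riemann A B C D y * frame_raised_all A B C D y)"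
  unfolding inv_I1_def weyl_eq raise_all_eq by (rule contract_four_slots[OF y])

lemma det_metric: "det (g y) = (det (\<chi> A a. E A a y))\<^sup>2 * (\<eta> 1 y * \<eta> 2 y * \<eta> 3 y * \<eta> 4 y)"
proof -
  have g: "g y = transpose (\<chi> A a. E A a y) ** (\<chi> A a. \<eta> A y * E A a y)"
    by (simp add: vec_eq_iff metric[OF y] matrix_matrix_mult_def transpose_def mult_ac)
  have E: "det (\<chi> A a. \<eta> A y * E A a y) = prod (\<lambda>A. \<eta> A y) UNIV * det (\<chi> A a. E A a y)"
    using det_rows_mul[of "\<lambda>A. \<eta> A y" "\<lambda>A. \<chi> a. E A a y"] by (simp add: vector_scalar_mult_def)
  have "prod (\<lambda>A. \<eta> A y) UNIV = \<eta> 1 y * \<eta> 2 y * \<eta> 3 y * \<eta> 4 y"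
    by (simp only: UNIV_4) simp
  then show ?thesis
    by (simp only: g det_mul det_transpose E power2_eq_square mult_ac)
qed

text \<open>Pulling the symbol back along the coframe costs det \<open>E\<close>. It stays as a
  factor because its sign against the positive root is the orientation, which only the concrete
  metric decides.\<close>

lemma levi_civita_eq:
  "det (\<chi> A a. E A a y) * levi_civita g y a b s t = sqrt \<bar>det (g y)\<bar> *
    (\<Sum>P\<in>UNIV. E P s y * (\<Sum>Q\<in>UNIV. E Q t y * (\<Sum>A\<in>UNIV. E A a y * (\<Sum>B\<in>UNIV. E B b y *
      levi_civita_symbol A B P Q))))"
proof -
  have "levi_civita_symbol a b s t * det (\<chi> a A. E A a y) = (\<Sum>A\<in>UNIV. \<Sum>B\<in>UNIV. \<Sum>P\<in>UNIV. \<Sum>Q\<in>UNIV.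
      levi_civita_symbol A B P Q * (E A a y * E B b y * E P s y * E Q t y))"
    by (rule levi_civita_symbol_contract[symmetric])
  also have "\<dots> = (\<Sum>A\<in>UNIV. E A a y * (\<Sum>B\<in>UNIV. E B b y *
      (\<Sum>P\<in>UNIV. E P s y * (\<Sum>Q\<in>UNIV. E Q t y * levi_civita_symbol A B P Q))))"
    by (simp add: sum_distrib_left mult_ac)
  also have "\<dots> = (\<Sum>P\<in>UNIV. E P s y * (\<Sum>Q\<in>UNIV. E Q t y * (\<Sum>A\<in>UNIV. E A a y * (\<Sum>B\<in>UNIV. E B b y *
      levi_civita_symbol A B P Q))))"
    by (rule swap_blocks)
  also have "det (\<chi> a A. E A a y) = det (\<chi> A a. E A a y)"
    using det_transpose[of "\<chi> A a. E A a y"] by (simp add: transpose_def)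
  finally show ?thesis unfolding levi_civita_def by (simp add: mult_ac)
qed

lemma pull_out_two:
  "(\<Sum>P\<in>UNIV. \<Sum>Q\<in>UNIV. (\<Sum>A\<in>UNIV. f A * (\<Sum>B\<in>UNIV. h B * X A B P Q)) * Y P Q)
    = (\<Sum>A\<in>UNIV. f A * (\<Sum>B\<in>UNIV. h B * (\<Sum>P\<in>UNIV. \<Sum>Q\<in>UNIV. X A B P Q * Y P Q)))"
  for X :: "4 \<Rightarrow> 4 \<Rightarrow> 4 \<Rightarrow> 4 \<Rightarrow> real"
proof -
  have "(\<Sum>P\<in>UNIV. \<Sum>Q\<in>UNIV. (\<Sum>A\<in>UNIV. f A * (\<Sum>B\<in>UNIV. h B * X A B P Q)) * Y P Q)
      = (\<Sum>P\<in>UNIV. \<Sum>Q\<in>UNIV. \<Sum>A\<in>UNIV. \<Sum>B\<in>UNIV. f A * h B * (X A B P Q * Y P Q))"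
    by (simp add: sum_distrib_left sum_distrib_right mult.assoc)
  also have "\<dots> = (\<Sum>A\<in>UNIV. \<Sum>B\<in>UNIV. \<Sum>P\<in>UNIV. \<Sum>Q\<in>UNIV. f A * h B * (X A B P Q * Y P Q))"
    by (subst sum_rotate3[symmetric]) (intro sum.cong refl sum_rotate3)
  finally show ?thesis by (simp add: sum_distrib_left mult.assoc)
qed

lemma dual_weyl_eq:
  "det (\<chi> A a. E A a y) * dual_weyl g y a b c d = 1/2 * sqrt \<bar>det (g y)\<bar> *
    (\<Sum>A\<in>UNIV. E A a y * (\<Sum>B\<in>UNIV. E B b y *
      (\<Sum>C\<in>UNIV. E C c y * (\<Sum>D\<in>UNIV. E D d y * frame_dual A B C D y))))"
proof -
  let ?Y = "\<lambda>P Q. \<Sum>C\<in>UNIV. E C c y * (\<Sum>D\<in>UNIV. E D d y * frame_raised P Q C D y)"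
  have dual: "(\<Sum>P\<in>UNIV. \<Sum>Q\<in>UNIV. levi_civita_symbol A B P Q * ?Y P Q)
      = (\<Sum>C\<in>UNIV. E C c y * (\<Sum>D\<in>UNIV. E D d y * frame_dual A B C D y))" for A B
    unfolding frame_dual_def
    using pull_out_two[of "\<lambda>C. E C c y" "\<lambda>D. E D d y" "\<lambda>C D P Q. frame_raised P Q C D y" "levi_civita_symbol A B"]
    by (simp add: mult.commute)
  have "det (\<chi> A a. E A a y) * dual_weyl g y a b c d = 1/2 * (\<Sum>s\<in>UNIV. \<Sum>t\<in>UNIV.
      (det (\<chi> A a. E A a y) * levi_civita g y a b s t) * raise_first g (weyl g) y s t c d)"
    unfolding dual_weyl_def by (simp add: sum_distrib_left mult_ac)
  also have "\<dots> = 1/2 * sqrt \<bar>det (g y)\<bar> * (\<Sum>s\<in>UNIV. \<Sum>t\<in>UNIV.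
      (\<Sum>P\<in>UNIV. E P s y * (\<Sum>Q\<in>UNIV. E Q t y * (\<Sum>A\<in>UNIV. E A a y * (\<Sum>B\<in>UNIV. E B b y *
      levi_civita_symbol A B P Q)))) * (\<Sum>P\<in>UNIV. e P s y * (\<Sum>Q\<in>UNIV. e Q t y * ?Y P Q)))"
    unfolding levi_civita_eq raise_first_eq by (simp only: mult.assoc sum_distrib_left[symmetric])
  also have "\<dots> = 1/2 * sqrt \<bar>det (g y)\<bar> * (\<Sum>P\<in>UNIV. \<Sum>Q\<in>UNIV.
      (\<Sum>A\<in>UNIV. E A a y * (\<Sum>B\<in>UNIV. E B b y * levi_civita_symbol A B P Q)) * ?Y P Q)"
    by (simp only: contract_two_slots[OF y])
  also have "\<dots> = 1/2 * sqrt \<bar>det (g y)\<bar> * (\<Sum>A\<in>UNIV. E A a y * (\<Sum>B\<in>UNIV. E B b y *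
      (\<Sum>P\<in>UNIV. \<Sum>Q\<in>UNIV. levi_civita_symbol A B P Q * ?Y P Q)))"
    by (simp only: pull_out_two)
  finally show ?thesis by (simp only: dual)
qed

lemma inv_I2_eq:
  "det (\<chi> A a. E A a y) * inv_I2 g y = 1/2 * sqrt \<bar>det (g y)\<bar> *
    (\<Sum>A\<in>UNIV. \<Sum>B\<in>UNIV. \<Sum>C\<in>UNIV. \<Sum>D\<in>UNIV. frame_dual A B C D y * frame_raised_all A B C D y)"
proof -
  have "det (\<chi> A a. E A a y) * inv_I2 g y = (\<Sum>a\<in>UNIV. \<Sum>b\<in>UNIV. \<Sum>c\<in>UNIV. \<Sum>d\<in>UNIV.
      (det (\<chi> A a. E A a y) * dual_weyl g y a b c d) * raise_all g (weyl g) y a b c d)"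
    unfolding inv_I2_def by (simp add: sum_distrib_left mult.assoc)
  also have "\<dots> = 1/2 * sqrt \<bar>det (g y)\<bar> * (\<Sum>a\<in>UNIV. \<Sum>b\<in>UNIV. \<Sum>c\<in>UNIV. \<Sum>d\<in>UNIV.
      (\<Sum>A\<in>UNIV. E A a y * (\<Sum>B\<in>UNIV. E B b y *
      (\<Sum>C\<in>UNIV. E C c y * (\<Sum>D\<in>UNIV. E D d y * frame_dual A B C D y)))) *
      (\<Sum>A\<in>UNIV. e A a y * (\<Sum>B\<in>UNIV. e B b y *
    (\<Sum>C\<in>UNIV. e C c y * (\<Sum>D\<in>UNIV. e D d y * frame_raised_all A B C D y)))))"
    unfolding dual_weyl_eq raise_all_eq by (simp only: mult.assoc sum_distrib_left[symmetric])
  finally show ?thesis by (simp only: contract_four_slots[OF y])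
qed

end

end

section \<open>The accelerating Kerr metric\<close>

definition vec4 :: "'a \<Rightarrow> 'a \<Rightarrow> 'a \<Rightarrow> 'a \<Rightarrow> 4 \<Rightarrow> 'a" where
  "vec4 w x y z i = (if i = 1 then w else if i = 2 then x else if i = 3 then y else z)"

lemma vec4_simps [simp]:
  "vec4 w x y z 1 = w" "vec4 w x y z 2 = x" "vec4 w x y z 3 = y" "vec4 w x y z 4 = z"
  by (simp_all add: vec4_def)

text \<open>Purely syntactic rules without side conditions on denominators: applied repeatedly after
  \<open>DERIV_cong\<close> they compute a derivative and leave one polynomial identity for
  \<open>algebra\<close>.\<close>

lemma poly_derivs:
  fixes f g :: "real \<Rightarrow> real"
  shows "((\<lambda>x. k) has_real_derivative 0) (at x)"
    and "((\<lambda>x. x) has_real_derivative 1) (at x)"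
    and "(f has_real_derivative D) (at x) \<Longrightarrow> ((\<lambda>x. - f x) has_real_derivative - D) (at x)"
    and "(f has_real_derivative D) (at x) \<Longrightarrow> ((\<lambda>x. f x / k) has_real_derivative D / k) (at x)"
    and "(f has_real_derivative D) (at x) \<Longrightarrow> ((\<lambda>x. (f x)\<^sup>2) has_real_derivative 2 * f x * D) (at x)"
    and "(f has_real_derivative D) (at x) \<Longrightarrow> ((\<lambda>x. (f x)^3) has_real_derivative 3 * (f x)\<^sup>2 * D) (at x)"
    and "(f has_real_derivative D) (at x) \<Longrightarrow> ((\<lambda>x. (f x)^4) has_real_derivative 4 * (f x)^3 * D) (at x)"
    and "(f has_real_derivative D) (at x) \<Longrightarrow> (g has_real_derivative D') (at x) \<Longrightarrow>
      ((\<lambda>x. f x + g x) has_real_derivative D + D') (at x)"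
    and "(f has_real_derivative D) (at x) \<Longrightarrow> (g has_real_derivative D') (at x) \<Longrightarrow>
      ((\<lambda>x. f x - g x) has_real_derivative D - D') (at x)"
    and "(f has_real_derivative D) (at x) \<Longrightarrow> (g has_real_derivative D') (at x) \<Longrightarrow>
      ((\<lambda>x. f x * g x) has_real_derivative D * g x + f x * D') (at x)"
  by (auto intro!: derivative_eq_intros DERIV_cdivide simp: mult_ac)

lemma has_partial_coords:
  assumes "((\<lambda>r. f r (y $ 3)) has_real_derivative D) (at (y $ 2))"
    and "((\<lambda>\<theta>. f (y $ 2) \<theta>) has_real_derivative D') (at (y $ 3))"
  shows "has_partial i (\<lambda>y. f (y $ 2) (y $ 3)) y (vec4 0 D D' 0 i)"
proof -
  have "((\<lambda>s. f (s + y $ 2) (y $ 3)) has_real_derivative D) (at 0)"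
    using assms(1) by (simp add: DERIV_shift[of _ _ 0 "y $ 2", simplified])
  moreover have "((\<lambda>s. f (y $ 2) (s + y $ 3)) has_real_derivative D') (at 0)"
    using assms(2) by (simp add: DERIV_shift[of _ _ 0 "y $ 3", simplified])
  ultimately show ?thesis
    using exhaust_4[of i] unfolding has_partial_def
    by (elim disjE) (simp_all add: axis_def add.commute)
qed

lemma DERIV_cos_comp:
  "(f has_real_derivative D) (at (cos \<theta>)) \<Longrightarrow> ((\<lambda>\<theta>. f (cos \<theta>)) has_real_derivative - (sin \<theta> * D)) (at \<theta>)"
  using DERIV_chain2[OF _ DERIV_cos, of f D \<theta>] by (simp add: mult.commute)

section \<open>Metric functions and connection coefficients in r and c\<close>

locale acc_kerr_params =
  fixes a \<alpha> m :: real
begin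

definition Qf :: "real \<Rightarrow> real" where "Qf r = (a\<^sup>2 - 2 * m * r + r\<^sup>2) * (1 - \<alpha>\<^sup>2 * r\<^sup>2)"
definition dQf :: "real \<Rightarrow> real" where
  "dQf r = (2 * r - 2 * m) * (1 - \<alpha>\<^sup>2 * r\<^sup>2) - 2 * \<alpha>\<^sup>2 * r * (a\<^sup>2 - 2 * m * r + r\<^sup>2)"
definition ddQf :: "real \<Rightarrow> real" where
  "ddQf r = 2 * (1 - \<alpha>\<^sup>2 * r\<^sup>2) - 4 * \<alpha>\<^sup>2 * r * (2 * r - 2 * m) - 2 * \<alpha>\<^sup>2 * (a\<^sup>2 - 2 * m * r + r\<^sup>2)"
definition Xf :: "real \<Rightarrow> real" where "Xf c = (1 - 2 * \<alpha> * m * c + \<alpha>\<^sup>2 * a\<^sup>2 * c\<^sup>2) * (1 - c\<^sup>2)"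
definition dXf :: "real \<Rightarrow> real" where
  "dXf c = (2 * \<alpha>\<^sup>2 * a\<^sup>2 * c - 2 * \<alpha> * m) * (1 - c\<^sup>2) - 2 * c * (1 - 2 * \<alpha> * m * c + \<alpha>\<^sup>2 * a\<^sup>2 * c\<^sup>2)"
definition ddXf :: "real \<Rightarrow> real" where
  "ddXf c = 2 * \<alpha>\<^sup>2 * a\<^sup>2 * (1 - c\<^sup>2) - 4 * c * (2 * \<alpha>\<^sup>2 * a\<^sup>2 * c - 2 * \<alpha> * m)
     - 2 * (1 - 2 * \<alpha> * m * c + \<alpha>\<^sup>2 * a\<^sup>2 * c\<^sup>2)"
definition \<rho>f :: "real \<Rightarrow> real \<Rightarrow> real" where "\<rho>f r c = r\<^sup>2 + a\<^sup>2 * c\<^sup>2"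
definition \<Omega>f :: "real \<Rightarrow> real \<Rightarrow> real" where "\<Omega>f r c = 1 - \<alpha> * r * c"
text \<open>
  Keeping 1/rho^2 and 1/Omega as the atoms \<open>R\<close> and \<open>Oi\<close> makes all entries of the tables below polynomials.
\<close>

definition R :: "real \<Rightarrow> real \<Rightarrow> real" where "R r c = inverse (\<rho>f r c)"
definition Oi :: "real \<Rightarrow> real \<Rightarrow> real" where "Oi r c = inverse (\<Omega>f r c)"

text \<open>
  Half the logarithmic derivatives of rho^2/Omega^2 (\<open>lr\<close>, \<open>lc\<close>) and of 1/(rho^2 Omega^2) (\<open>mr\<close>, \<open>mc\<close>)
  with respect to r and c; \<open>lrc\<close> and \<open>mrc\<close> are the mixed derivatives.
\<close>

definition lr :: "real \<Rightarrow> real \<Rightarrow> real" where "lr r c = r * R r c + \<alpha> * c * Oi r c"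
definition lc :: "real \<Rightarrow> real \<Rightarrow> real" where "lc r c = a\<^sup>2 * c * R r c + \<alpha> * r * Oi r c"
definition mr :: "real \<Rightarrow> real \<Rightarrow> real" where "mr r c = - (r * R r c) + \<alpha> * c * Oi r c"
definition mc :: "real \<Rightarrow> real \<Rightarrow> real" where "mc r c = - (a\<^sup>2 * c * R r c) + \<alpha> * r * Oi r c"

definition lr_r :: "real \<Rightarrow> real \<Rightarrow> real" where "lr_r r c = R r c - 2 * r\<^sup>2 * (R r c)\<^sup>2 + \<alpha>\<^sup>2 * c\<^sup>2 * (Oi r c)\<^sup>2"
definition mr_r :: "real \<Rightarrow> real \<Rightarrow> real" where "mr_r r c = - R r c + 2 * r\<^sup>2 * (R r c)\<^sup>2 + \<alpha>\<^sup>2 * c\<^sup>2 * (Oi r c)\<^sup>2"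
definition lc_c :: "real \<Rightarrow> real \<Rightarrow> real" where
  "lc_c r c = a\<^sup>2 * R r c - 2 * a^4 * c\<^sup>2 * (R r c)\<^sup>2 + \<alpha>\<^sup>2 * r\<^sup>2 * (Oi r c)\<^sup>2"
definition mc_c :: "real \<Rightarrow> real \<Rightarrow> real" where
  "mc_c r c = - (a\<^sup>2 * R r c) + 2 * a^4 * c\<^sup>2 * (R r c)\<^sup>2 + \<alpha>\<^sup>2 * r\<^sup>2 * (Oi r c)\<^sup>2"
definition lrc :: "real \<Rightarrow> real \<Rightarrow> real" where
  "lrc r c = - (2 * a\<^sup>2 * r * c * (R r c)\<^sup>2) + \<alpha> * Oi r c + \<alpha>\<^sup>2 * r * c * (Oi r c)\<^sup>2"
definition mrc :: "real \<Rightarrow> real \<Rightarrow> real" where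
  "mrc r c = 2 * a\<^sup>2 * r * c * (R r c)\<^sup>2 + \<alpha> * Oi r c + \<alpha>\<^sup>2 * r * c * (Oi r c)\<^sup>2"

text \<open>The entry A, B, C is omega^A_B(e_C), found with the Koszul formula.\<close>

definition \<omega>t :: "real \<Rightarrow> real \<Rightarrow> 4 \<Rightarrow> 4 \<Rightarrow> 4 \<Rightarrow> real" where
  "\<omega>t r c = vec4
    (vec4 (vec4 0 (dQf r / 2 + Qf r * mr r c) (Xf c * mc r c) 0)
          (vec4 (dQf r / 2 + Qf r * mr r c) 0 0 (a * r * Xf c * R r c))
          (vec4 (Xf c * lc r c) 0 0 (- (a * c * Xf c * R r c)))
          (vec4 0 (a * r * Xf c * R r c) (a * c * Xf c * R r c) 0))
    (vec4 (vec4 ((R r c)\<^sup>2 * (dQf r / 2 + Qf r * mr r c)) 0 0 (a * r * Xf c * R r c ^ 3))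
          (vec4 0 (dQf r / 2 + Qf r * lr r c) (Xf c * lc r c) 0)
          (vec4 0 (Xf c * lc r c) (- (Xf c * lr r c)) 0)
          (vec4 (a * r * Xf c * R r c ^ 3) 0 0 (- (Xf c * (R r c)\<^sup>2 * lr r c))))
    (vec4 (vec4 (Qf r * (R r c)\<^sup>2 * lc r c) 0 0 (- (a * c * Qf r * R r c ^ 3)))
          (vec4 0 (- (Qf r * lc r c)) (Qf r * lr r c) 0)
          (vec4 0 (Qf r * lr r c) (dXf c / 2 + Xf c * lc r c) 0)
          (vec4 (- (a * c * Qf r * R r c ^ 3)) 0 0 (- ((R r c)\<^sup>2 * (dXf c / 2 + Xf c * mc r c)))))
    (vec4 (vec4 0 (a * r * Qf r * R r c) (a * c * Qf r * R r c) 0)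
          (vec4 (- (a * r * Qf r * R r c)) 0 0 (Qf r * lr r c))
          (vec4 (a * c * Qf r * R r c) 0 0 (dXf c / 2 + Xf c * mc r c))
          (vec4 0 (Qf r * mr r c) (dXf c / 2 + Xf c * mc r c) 0))"

definition \<omega>t_r :: "real \<Rightarrow> real \<Rightarrow> 4 \<Rightarrow> 4 \<Rightarrow> 4 \<Rightarrow> real" where
  "\<omega>t_r r c = vec4
    (vec4 (vec4 0 (ddQf r / 2 + dQf r * mr r c + Qf r * mr_r r c) (Xf c * mrc r c) 0)
          (vec4 (ddQf r / 2 + dQf r * mr r c + Qf r * mr_r r c) 0 0 (a * Xf c * (R r c - 2 * r\<^sup>2 * (R r c)\<^sup>2)))
          (vec4 (Xf c * lrc r c) 0 0 (2 * a * r * c * Xf c * (R r c)\<^sup>2))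
          (vec4 0 (a * Xf c * (R r c - 2 * r\<^sup>2 * (R r c)\<^sup>2)) (- (2 * a * r * c * Xf c * (R r c)\<^sup>2)) 0))
    (vec4 (vec4 ((R r c)\<^sup>2 * (ddQf r / 2 + dQf r * mr r c + Qf r * mr_r r c) - 4 * r * R r c ^ 3 * (dQf r / 2 + Qf r * mr r c)) 0 0
            (a * Xf c * (R r c ^ 3 - 6 * r\<^sup>2 * R r c ^ 4)))
          (vec4 0 (ddQf r / 2 + dQf r * lr r c + Qf r * lr_r r c) (Xf c * lrc r c) 0)
          (vec4 0 (Xf c * lrc r c) (- (Xf c * lr_r r c)) 0)
          (vec4 (a * Xf c * (R r c ^ 3 - 6 * r\<^sup>2 * R r c ^ 4)) 0 0
            (- (Xf c * ((R r c)\<^sup>2 * lr_r r c - 4 * r * R r c ^ 3 * lr r c)))))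
    (vec4 (vec4 (dQf r * (R r c)\<^sup>2 * lc r c - 4 * r * Qf r * R r c ^ 3 * lc r c + Qf r * (R r c)\<^sup>2 * lrc r c) 0 0
            (- (a * c * (dQf r * R r c ^ 3 - 6 * r * Qf r * R r c ^ 4))))
          (vec4 0 (- (dQf r * lc r c + Qf r * lrc r c)) (dQf r * lr r c + Qf r * lr_r r c) 0)
          (vec4 0 (dQf r * lr r c + Qf r * lr_r r c) (Xf c * lrc r c) 0)
          (vec4 (- (a * c * (dQf r * R r c ^ 3 - 6 * r * Qf r * R r c ^ 4))) 0 0
            (- ((R r c)\<^sup>2 * (Xf c * mrc r c) - 4 * r * R r c ^ 3 * (dXf c / 2 + Xf c * mc r c)))))
    (vec4 (vec4 0 (a * (Qf r * R r c + r * dQf r * R r c - 2 * r\<^sup>2 * Qf r * (R r c)\<^sup>2))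
            (a * c * (dQf r * R r c - 2 * r * Qf r * (R r c)\<^sup>2)) 0)
          (vec4 (- (a * (Qf r * R r c + r * dQf r * R r c - 2 * r\<^sup>2 * Qf r * (R r c)\<^sup>2))) 0 0
            (dQf r * lr r c + Qf r * lr_r r c))
          (vec4 (a * c * (dQf r * R r c - 2 * r * Qf r * (R r c)\<^sup>2)) 0 0 (Xf c * mrc r c))
          (vec4 0 (dQf r * mr r c + Qf r * mr_r r c) (Xf c * mrc r c) 0))"

definition \<omega>t_c :: "real \<Rightarrow> real \<Rightarrow> 4 \<Rightarrow> 4 \<Rightarrow> 4 \<Rightarrow> real" where
  "\<omega>t_c r c = vec4
    (vec4 (vec4 0 (Qf r * mrc r c) (dXf c * mc r c + Xf c * mc_c r c) 0)
          (vec4 (Qf r * mrc r c) 0 0 (a * r * (dXf c * R r c - 2 * a\<^sup>2 * c * Xf c * (R r c)\<^sup>2)))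
          (vec4 (dXf c * lc r c + Xf c * lc_c r c) 0 0
            (- (a * (Xf c * R r c + c * dXf c * R r c - 2 * a\<^sup>2 * c\<^sup>2 * Xf c * (R r c)\<^sup>2))))
          (vec4 0 (a * r * (dXf c * R r c - 2 * a\<^sup>2 * c * Xf c * (R r c)\<^sup>2))
            (a * (Xf c * R r c + c * dXf c * R r c - 2 * a\<^sup>2 * c\<^sup>2 * Xf c * (R r c)\<^sup>2)) 0))
    (vec4 (vec4 ((R r c)\<^sup>2 * (Qf r * mrc r c) - 4 * a\<^sup>2 * c * R r c ^ 3 * (dQf r / 2 + Qf r * mr r c)) 0 0
            (a * r * (dXf c * R r c ^ 3 - 6 * a\<^sup>2 * c * Xf c * R r c ^ 4)))
          (vec4 0 (Qf r * lrc r c) (dXf c * lc r c + Xf c * lc_c r c) 0)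
          (vec4 0 (dXf c * lc r c + Xf c * lc_c r c) (- (dXf c * lr r c + Xf c * lrc r c)) 0)
          (vec4 (a * r * (dXf c * R r c ^ 3 - 6 * a\<^sup>2 * c * Xf c * R r c ^ 4)) 0 0
            (- (dXf c * (R r c)\<^sup>2 * lr r c - 4 * a\<^sup>2 * c * Xf c * R r c ^ 3 * lr r c + Xf c * (R r c)\<^sup>2 * lrc r c))))
    (vec4 (vec4 (Qf r * ((R r c)\<^sup>2 * lc_c r c - 4 * a\<^sup>2 * c * R r c ^ 3 * lc r c)) 0 0
            (- (a * Qf r * (R r c ^ 3 - 6 * a\<^sup>2 * c\<^sup>2 * R r c ^ 4))))
          (vec4 0 (- (Qf r * lc_c r c)) (Qf r * lrc r c) 0)
          (vec4 0 (Qf r * lrc r c) (ddXf c / 2 + dXf c * lc r c + Xf c * lc_c r c) 0)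
          (vec4 (- (a * Qf r * (R r c ^ 3 - 6 * a\<^sup>2 * c\<^sup>2 * R r c ^ 4))) 0 0
            (- ((R r c)\<^sup>2 * (ddXf c / 2 + dXf c * mc r c + Xf c * mc_c r c)
              - 4 * a\<^sup>2 * c * R r c ^ 3 * (dXf c / 2 + Xf c * mc r c)))))
    (vec4 (vec4 0 (- (2 * a ^ 3 * r * c * Qf r * (R r c)\<^sup>2)) (a * Qf r * (R r c - 2 * a\<^sup>2 * c\<^sup>2 * (R r c)\<^sup>2)) 0)
          (vec4 (2 * a ^ 3 * r * c * Qf r * (R r c)\<^sup>2) 0 0 (Qf r * lrc r c))
          (vec4 (a * Qf r * (R r c - 2 * a\<^sup>2 * c\<^sup>2 * (R r c)\<^sup>2)) 0 0 (ddXf c / 2 + dXf c * mc r c + Xf c * mc_c r c))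
          (vec4 0 (Qf r * mrc r c) (ddXf c / 2 + dXf c * mc r c + Xf c * mc_c r c) 0))"

text \<open>Derivatives along the frame vectors: e_2 is Q d/dr and e_3 is X d/dc, while e_1 and e_4
  combine d/dt and d/dphi, on which nothing depends.\<close>

definition d\<omega>t :: "real \<Rightarrow> real \<Rightarrow> 4 \<Rightarrow> 4 \<Rightarrow> 4 \<Rightarrow> 4 \<Rightarrow> real" where
  "d\<omega>t r c D A B C = vec4 0 (Qf r * \<omega>t_r r c A B C) (Xf c * \<omega>t_c r c A B C) 0 D"

text \<open>The expression \<open>frame_curvature\<close> as a function of the two numbers r and c,
  so that its entries can be checked before the coframe locale is interpreted.\<close>

definition frame_curv :: "real \<Rightarrow> real \<Rightarrow> 4 \<Rightarrow> 4 \<Rightarrow> 4 \<Rightarrow> 4 \<Rightarrow> real" where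
  "frame_curv r c A B C D = d\<omega>t r c C A B D - d\<omega>t r c D A B C
     + (\<Sum>K\<in>UNIV. \<omega>t r c A K C * \<omega>t r c K B D - \<omega>t r c A K D * \<omega>t r c K B C)
     + (\<Sum>K\<in>UNIV. \<omega>t r c A B K * (\<omega>t r c K C D - \<omega>t r c K D C))"

text \<open>\<open>uf + i vf = m (1 + i \<alpha> a) (r + i a c)^3\<close>.\<close>

definition uf :: "real \<Rightarrow> real \<Rightarrow> real" where
  "uf r c = m * ((r^3 - 3 * r * a\<^sup>2 * c\<^sup>2) - \<alpha> * a * (3 * r\<^sup>2 * a * c - a^3 * c^3))"
definition vf :: "real \<Rightarrow> real \<Rightarrow> real" where
  "vf r c = m * ((3 * r\<^sup>2 * a * c - a^3 * c^3) + \<alpha> * a * (r^3 - 3 * r * a\<^sup>2 * c\<^sup>2))"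

section \<open>Derivatives of the metric functions and of the connection table\<close>

lemma Qf_deriv: "(Qf has_real_derivative dQf r) (at r)"
  unfolding Qf_def[abs_def] dQf_def
  by (rule DERIV_cong, (rule poly_derivs)+, algebra)

lemma dQf_deriv: "(dQf has_real_derivative ddQf r) (at r)"
  unfolding dQf_def[abs_def] ddQf_def
  by (rule DERIV_cong, (rule poly_derivs)+, algebra)

lemma Xf_deriv: "(Xf has_real_derivative dXf c) (at c)"
  unfolding Xf_def[abs_def] dXf_def
  by (rule DERIV_cong, (rule poly_derivs)+, algebra)

lemma dXf_deriv: "(dXf has_real_derivative ddXf c) (at c)"
  unfolding dXf_def[abs_def] ddXf_def
  by (rule DERIV_cong, (rule poly_derivs)+, algebra)

context
  fixes r c :: real
  assumes nz: "\<rho>f r c \<noteq> 0" "\<Omega>f r c \<noteq> 0"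
begin

lemma R_deriv:
  "((\<lambda>r. R r c) has_real_derivative - (2 * r * (R r c)\<^sup>2)) (at r)"
  "((\<lambda>c. R r c) has_real_derivative - (2 * a\<^sup>2 * c * (R r c)\<^sup>2)) (at c)"
  using nz unfolding R_def \<rho>f_def
  by (auto intro!: derivative_eq_intros simp: power2_eq_square)

lemma Oi_deriv:
  "((\<lambda>r. Oi r c) has_real_derivative \<alpha> * c * (Oi r c)\<^sup>2) (at r)"
  "((\<lambda>c. Oi r c) has_real_derivative \<alpha> * r * (Oi r c)\<^sup>2) (at c)"
  using nz unfolding Oi_def \<Omega>f_def
  by (auto intro!: derivative_eq_intros simp: power2_eq_square)

lemma lr_deriv:
  "((\<lambda>r. lr r c) has_real_derivative lr_r r c) (at r)"
  "((\<lambda>c. lr r c) has_real_derivative lrc r c) (at c)"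
  unfolding lr_def lr_r_def lrc_def by (rule DERIV_cong, (rule poly_derivs R_deriv Oi_deriv)+, algebra)+

lemma lc_deriv:
  "((\<lambda>r. lc r c) has_real_derivative lrc r c) (at r)"
  "((\<lambda>c. lc r c) has_real_derivative lc_c r c) (at c)"
  unfolding lc_def lc_c_def lrc_def by (rule DERIV_cong, (rule poly_derivs R_deriv Oi_deriv)+, algebra)+

lemma mr_deriv:
  "((\<lambda>r. mr r c) has_real_derivative mr_r r c) (at r)"
  "((\<lambda>c. mr r c) has_real_derivative mrc r c) (at c)"
  unfolding mr_def mr_r_def mrc_def by (rule DERIV_cong, (rule poly_derivs R_deriv Oi_deriv)+, algebra)+

lemma mc_deriv:
  "((\<lambda>r. mc r c) has_real_derivative mrc r c) (at r)"
  "((\<lambda>c. mc r c) has_real_derivative mc_c r c) (at c)"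
  unfolding mc_def mc_c_def mrc_def by (rule DERIV_cong, (rule poly_derivs R_deriv Oi_deriv)+, algebra)+

lemmas all_derivs = R_deriv Oi_deriv lr_deriv lc_deriv mr_deriv mc_deriv Qf_deriv dQf_deriv Xf_deriv dXf_deriv

lemma \<omega>t_deriv_r: "((\<lambda>r. \<omega>t r c A B C) has_real_derivative \<omega>t_r r c A B C) (at r)"
proof -
  have "\<forall>A B C. ((\<lambda>r. \<omega>t r c A B C) has_real_derivative \<omega>t_r r c A B C) (at r)"
    unfolding forall_4 \<omega>t_def \<omega>t_r_def vec4_simps
    by (intro conjI; (rule DERIV_cong, (rule poly_derivs all_derivs)+, (simp; fail | algebra)))
  then show ?thesis by simp
qed

lemma \<omega>t_deriv_c: "((\<lambda>c. \<omega>t r c A B C) has_real_derivative \<omega>t_c r c A B C) (at c)"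
proof -
  have "\<forall>A B C. ((\<lambda>c. \<omega>t r c A B C) has_real_derivative \<omega>t_c r c A B C) (at c)"
    unfolding forall_4 \<omega>t_def \<omega>t_c_def vec4_simps
    by (intro conjI; (rule DERIV_cong, (rule poly_derivs all_derivs)+, (simp; fail | algebra)))
  then show ?thesis by simp
qed

end

text \<open>The eigenvalue ratio 2 : -1 : -1 of a type D Weyl tensor. The distinguished planes are
  12, which contains the two principal null directions, and its complement 34.\<close>

definition type_D_weight :: "4 \<Rightarrow> 4 \<Rightarrow> real" where
  "type_D_weight A B = vec4 (vec4 0 2 (-1) (-1)) (vec4 2 0 (-1) (-1)) (vec4 (-1) (-1) 0 2) (vec4 (-1) (-1) 2 0) A B"

definition Kdiag :: "real \<Rightarrow> real \<Rightarrow> 4 \<Rightarrow> real" where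
  "Kdiag r c = vec4 (- (Qf r * \<Omega>f r c * uf r c * R r c ^ 4)) (Qf r * \<Omega>f r c * uf r c * (R r c)\<^sup>2)
     (Xf c * \<Omega>f r c * uf r c * (R r c)\<^sup>2) (Xf c * \<Omega>f r c * uf r c * R r c ^ 4)"

definition Kdual :: "real \<Rightarrow> real \<Rightarrow> 4 \<Rightarrow> real" where
  "Kdual r c = vec4 (- (Xf c * \<Omega>f r c * vf r c * (R r c)\<^sup>2)) (Xf c * \<Omega>f r c * vf r c * R r c ^ 4)
     (Qf r * \<Omega>f r c * vf r c * R r c ^ 4) (Qf r * \<Omega>f r c * vf r c * (R r c)\<^sup>2)"

text \<open>
  In the notation of \<open>type_D\<close> below, \<open>Kdiag\<close> is \<open>\<kappa> \<eta>\<close> and \<open>Kdual\<close> is \<open>\<nu> / \<eta>\<close>: the first frame index is raised here.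
\<close>

definition frame_weyl :: "real \<Rightarrow> real \<Rightarrow> 4 \<Rightarrow> 4 \<Rightarrow> 4 \<Rightarrow> 4 \<Rightarrow> real" where
  "frame_weyl r c A B C D = type_D_weight A B * (((if A = C \<and> B = D then 1 else 0) - (if A = D \<and> B = C then 1 else 0)) * Kdiag r c B
     + levi_civita_symbol A B C D * Kdual r c A)"

section \<open>The frame curvature, one pair of form indices at a time\<close>

lemma frame_curv_12: assumes nz: "\<rho>f r c \<noteq> 0" "\<Omega>f r c \<noteq> 0"
  shows "\<forall>A B. frame_curv r c A B 1 2 = frame_weyl r c A B 1 2"
  unfolding forall_4
  \<comment> \<open>The unfolding is staged to keep terms small: Q, X and their derivatives stay
    atoms until the denominators rho^2 and Omega are cleared. The explicit polynomials, on which the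
    vacuum property rests, enter only at the end.\<close>
  by (intro conjI; (simp add: frame_curv_def d\<omega>t_def \<omega>t_def \<omega>t_r_def \<omega>t_c_def sum_4
        frame_weyl_def type_D_weight_def Kdiag_def Kdual_def levi_civita_symbol_4)?;
    (simp add: lr_def mr_def lc_def mc_def lr_r_def mr_r_def lc_c_def mc_c_def lrc_def mrc_def)?;
    (simp add: R_def Oi_def nz divide_simps)?;
    (simp add: Qf_def dQf_def ddQf_def Xf_def dXf_def ddXf_def uf_def vf_def \<Omega>f_def \<rho>f_def)?;
    algebra)

lemma frame_curv_13: assumes nz: "\<rho>f r c \<noteq> 0" "\<Omega>f r c \<noteq> 0"
  shows "\<forall>A B. frame_curv r c A B 1 3 = frame_weyl r c A B 1 3"
  unfolding forall_4
  by (intro conjI; (simp add: frame_curv_def d\<omega>t_def \<omega>t_def \<omega>t_r_def \<omega>t_c_def sum_4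
        frame_weyl_def type_D_weight_def Kdiag_def Kdual_def levi_civita_symbol_4)?;
    (simp add: lr_def mr_def lc_def mc_def lr_r_def mr_r_def lc_c_def mc_c_def lrc_def mrc_def)?;
    (simp add: R_def Oi_def nz divide_simps)?;
    (simp add: Qf_def dQf_def ddQf_def Xf_def dXf_def ddXf_def uf_def vf_def \<Omega>f_def \<rho>f_def)?;
    algebra)

lemma frame_curv_14: assumes nz: "\<rho>f r c \<noteq> 0" "\<Omega>f r c \<noteq> 0"
  shows "\<forall>A B. frame_curv r c A B 1 4 = frame_weyl r c A B 1 4"
  unfolding forall_4
  by (intro conjI; (simp add: frame_curv_def d\<omega>t_def \<omega>t_def \<omega>t_r_def \<omega>t_c_def sum_4
        frame_weyl_def type_D_weight_def Kdiag_def Kdual_def levi_civita_symbol_4)?;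
    (simp add: lr_def mr_def lc_def mc_def lr_r_def mr_r_def lc_c_def mc_c_def lrc_def mrc_def)?;
    (simp add: R_def Oi_def nz divide_simps)?;
    (simp add: Qf_def dQf_def ddQf_def Xf_def dXf_def ddXf_def uf_def vf_def \<Omega>f_def \<rho>f_def)?;
    algebra)

lemma frame_curv_23: assumes nz: "\<rho>f r c \<noteq> 0" "\<Omega>f r c \<noteq> 0"
  shows "\<forall>A B. frame_curv r c A B 2 3 = frame_weyl r c A B 2 3"
  unfolding forall_4
  by (intro conjI; (simp add: frame_curv_def d\<omega>t_def \<omega>t_def \<omega>t_r_def \<omega>t_c_def sum_4
        frame_weyl_def type_D_weight_def Kdiag_def Kdual_def levi_civita_symbol_4)?;
    (simp add: lr_def mr_def lc_def mc_def lr_r_def mr_r_def lc_c_def mc_c_def lrc_def mrc_def)?;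
    (simp add: R_def Oi_def nz divide_simps)?;
    (simp add: Qf_def dQf_def ddQf_def Xf_def dXf_def ddXf_def uf_def vf_def \<Omega>f_def \<rho>f_def)?;
    algebra)

lemma frame_curv_24: assumes nz: "\<rho>f r c \<noteq> 0" "\<Omega>f r c \<noteq> 0"
  shows "\<forall>A B. frame_curv r c A B 2 4 = frame_weyl r c A B 2 4"
  unfolding forall_4
  by (intro conjI; (simp add: frame_curv_def d\<omega>t_def \<omega>t_def \<omega>t_r_def \<omega>t_c_def sum_4
        frame_weyl_def type_D_weight_def Kdiag_def Kdual_def levi_civita_symbol_4)?;
    (simp add: lr_def mr_def lc_def mc_def lr_r_def mr_r_def lc_c_def mc_c_def lrc_def mrc_def)?;
    (simp add: R_def Oi_def nz divide_simps)?;
    (simp add: Qf_def dQf_def ddQf_def Xf_def dXf_def ddXf_def uf_def vf_def \<Omega>f_def \<rho>f_def)?;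
    algebra)

lemma frame_curv_34: assumes nz: "\<rho>f r c \<noteq> 0" "\<Omega>f r c \<noteq> 0"
  shows "\<forall>A B. frame_curv r c A B 3 4 = frame_weyl r c A B 3 4"
  unfolding forall_4
  by (intro conjI; (simp add: frame_curv_def d\<omega>t_def \<omega>t_def \<omega>t_r_def \<omega>t_c_def sum_4
        frame_weyl_def type_D_weight_def Kdiag_def Kdual_def levi_civita_symbol_4)?;
    (simp add: lr_def mr_def lc_def mc_def lr_r_def mr_r_def lc_c_def mc_c_def lrc_def mrc_def)?;
    (simp add: R_def Oi_def nz divide_simps)?;
    (simp add: Qf_def dQf_def ddQf_def Xf_def dXf_def ddXf_def uf_def vf_def \<Omega>f_def \<rho>f_def)?;
    algebra)


lemma frame_curv_antisym: "frame_curv r c A B D C = - frame_curv r c A B C D"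
  by (simp add: frame_curv_def sum_4 algebra_simps)

lemma frame_weyl_antisym: "frame_weyl r c A B D C = - frame_weyl r c A B C D"
  by (simp add: frame_weyl_def levi_civita_symbol_antisym[of A B D C] algebra_simps)

lemma frame_curv_eq: assumes nz: "\<rho>f r c \<noteq> 0" "\<Omega>f r c \<noteq> 0"
  shows "frame_curv r c A B C D = frame_weyl r c A B C D"
proof -
  have same: "frame_curv r c A B C C = frame_weyl r c A B C C" for C
    using frame_curv_antisym[of r c A B C C] frame_weyl_antisym[of r c A B C C] by simp
  show ?thesis
    using exhaust_4[of C] exhaust_4[of D] same
      frame_curv_12[OF nz] frame_curv_13[OF nz] frame_curv_14[OF nz] frame_curv_23[OF nz] frame_curv_24[OF nz] frame_curv_34[OF nz]
      frame_curv_antisym[of r c A B C D] frame_weyl_antisym[of r c A B C D]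
    by (elim disjE) simp_all
qed

section \<open>The coframe, its dual frame and the frame metric\<close>

definition Pf :: "real \<Rightarrow> real" where "Pf c = 1 - 2 * \<alpha> * m * c + \<alpha>\<^sup>2 * a\<^sup>2 * c\<^sup>2"
definition Qi :: "real \<Rightarrow> real" where "Qi r = inverse (Qf r)"
definition Xi :: "real \<Rightarrow> real" where "Xi c = inverse (Xf c)"

lemma Qi_deriv: "Qf r \<noteq> 0 \<Longrightarrow> (Qi has_real_derivative - (dQf r * (Qi r)\<^sup>2)) (at r)"
  unfolding Qi_def[abs_def] by (auto intro!: derivative_eq_intros Qf_deriv simp: power2_eq_square)

lemma Xi_deriv: "Xf c \<noteq> 0 \<Longrightarrow> (Xi has_real_derivative - (dXf c * (Xi c)\<^sup>2)) (at c)"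
  unfolding Xi_def[abs_def] by (auto intro!: derivative_eq_intros Xf_deriv simp: power2_eq_square)

text \<open>Dividing dr by Q and dc by X moves these functions into the numerators: for instance
  (rho^2 / P) dtheta^2 = X rho^2 (dc / X)^2, because X = P sin^2 theta and dc = - sin theta
  dtheta.\<close>

definition \<eta>t :: "real \<Rightarrow> real \<Rightarrow> 4 \<Rightarrow> real" where
  "\<eta>t r c = vec4 (- (Qf r * R r c * (Oi r c)\<^sup>2)) (Qf r * \<rho>f r c * (Oi r c)\<^sup>2)
     (Xf c * \<rho>f r c * (Oi r c)\<^sup>2) (Xf c * R r c * (Oi r c)\<^sup>2)"

definition \<eta>t_r :: "real \<Rightarrow> real \<Rightarrow> 4 \<Rightarrow> real" where
  "\<eta>t_r r c = vec4 (- (2 * R r c * (Oi r c)\<^sup>2 * (dQf r / 2 + Qf r * mr r c)))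
     (2 * \<rho>f r c * (Oi r c)\<^sup>2 * (dQf r / 2 + Qf r * lr r c))
     (2 * Xf c * \<rho>f r c * (Oi r c)\<^sup>2 * lr r c) (2 * Xf c * R r c * (Oi r c)\<^sup>2 * mr r c)"

definition \<eta>t_c :: "real \<Rightarrow> real \<Rightarrow> 4 \<Rightarrow> real" where
  "\<eta>t_c r c = vec4 (- (2 * Qf r * R r c * (Oi r c)\<^sup>2 * mc r c)) (2 * Qf r * \<rho>f r c * (Oi r c)\<^sup>2 * lc r c)
     (2 * \<rho>f r c * (Oi r c)\<^sup>2 * (dXf c / 2 + Xf c * lc r c))
     (2 * R r c * (Oi r c)\<^sup>2 * (dXf c / 2 + Xf c * mc r c))"

definition Ef :: "real \<Rightarrow> real \<Rightarrow> 4 \<Rightarrow> 4 \<Rightarrow> real" where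
  "Ef r \<theta> = vec4 (vec4 1 0 0 (- (a * (sin \<theta>)\<^sup>2))) (vec4 0 (Qi r) 0 0)
     (vec4 0 0 (- (sin \<theta> * Xi (cos \<theta>))) 0) (vec4 a 0 0 (- (r\<^sup>2 + a\<^sup>2)))"

definition Ef_r :: "real \<Rightarrow> 4 \<Rightarrow> 4 \<Rightarrow> real" where
  "Ef_r r = vec4 (vec4 0 0 0 0) (vec4 0 (- (dQf r * (Qi r)\<^sup>2)) 0 0) (vec4 0 0 0 0) (vec4 0 0 0 (- (2 * r)))"

definition Ef_\<theta> :: "real \<Rightarrow> 4 \<Rightarrow> 4 \<Rightarrow> real" where
  "Ef_\<theta> \<theta> = vec4 (vec4 0 0 0 (- (2 * a * sin \<theta> * cos \<theta>))) (vec4 0 0 0 0)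
     (vec4 0 0 (- (cos \<theta> * Xi (cos \<theta>)) - (sin \<theta>)\<^sup>2 * dXf (cos \<theta>) * (Xi (cos \<theta>))\<^sup>2) 0) (vec4 0 0 0 0)"

definition Ef_rr :: "real \<Rightarrow> 4 \<Rightarrow> 4 \<Rightarrow> real" where
  "Ef_rr r = vec4 (vec4 0 0 0 0) (vec4 0 (- (ddQf r * (Qi r)\<^sup>2) + 2 * (dQf r)\<^sup>2 * (Qi r)^3) 0 0) (vec4 0 0 0 0) (vec4 0 0 0 (- 2))"

definition Ef_\<theta>\<theta> :: "real \<Rightarrow> 4 \<Rightarrow> 4 \<Rightarrow> real" where
  "Ef_\<theta>\<theta> \<theta> = vec4 (vec4 0 0 0 (- (2 * a * ((cos \<theta>)\<^sup>2 - (sin \<theta>)\<^sup>2)))) (vec4 0 0 0 0)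
     (vec4 0 0 (sin \<theta> * Xi (cos \<theta>) - 3 * sin \<theta> * cos \<theta> * dXf (cos \<theta>) * (Xi (cos \<theta>))\<^sup>2
        + (sin \<theta>)^3 * ddXf (cos \<theta>) * (Xi (cos \<theta>))\<^sup>2 - 2 * (sin \<theta>)^3 * (dXf (cos \<theta>))\<^sup>2 * (Xi (cos \<theta>))^3) 0) (vec4 0 0 0 0)"

text \<open>Third row: X d/dc = - (X / sin theta) d/dtheta = - P sin theta d/dtheta. Rows 1 and 4
  invert the t-phi block, whose determinant is -rho^2.\<close>

definition ef :: "real \<Rightarrow> real \<Rightarrow> 4 \<Rightarrow> 4 \<Rightarrow> real" where
  "ef r \<theta> = vec4 (vec4 ((r\<^sup>2 + a\<^sup>2) * R r (cos \<theta>)) 0 0 (a * R r (cos \<theta>))) (vec4 0 (Qf r) 0 0)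
     (vec4 0 0 (- (Pf (cos \<theta>) * sin \<theta>)) 0) (vec4 (- (a * (sin \<theta>)\<^sup>2 * R r (cos \<theta>))) 0 0 (- R r (cos \<theta>)))"

lemma \<eta>t_deriv:
  assumes nz: "\<rho>f r c \<noteq> 0" "\<Omega>f r c \<noteq> 0"
  shows "((\<lambda>r. \<eta>t r c A) has_real_derivative \<eta>t_r r c A) (at r)"
    and "((\<lambda>c. \<eta>t r c A) has_real_derivative \<eta>t_c r c A) (at c)"
proof -
  have \<rho>: "\<rho>f r c * R r c = 1" "\<rho>f r c = r\<^sup>2 + a\<^sup>2 * c\<^sup>2" using nz by (simp_all add: R_def \<rho>f_def)
  have \<rho>_deriv: "((\<lambda>r. \<rho>f r c) has_real_derivative 2 * r) (at r)" "((\<lambda>c. \<rho>f r c) has_real_derivative 2 * a\<^sup>2 * c) (at c)"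
    unfolding \<rho>f_def by (rule DERIV_cong, (rule poly_derivs)+, algebra)+
  note derivs = R_deriv[OF nz] Oi_deriv[OF nz] Qf_deriv Xf_deriv \<rho>_deriv
  have "\<forall>A. ((\<lambda>r. \<eta>t r c A) has_real_derivative \<eta>t_r r c A) (at r)"
    unfolding forall_4 \<eta>t_def \<eta>t_r_def vec4_simps lr_def mr_def
    by (intro conjI; (rule DERIV_cong, (rule poly_derivs derivs)+, (algebra | (use \<rho>(1) in algebra))))
  then show "((\<lambda>r. \<eta>t r c A) has_real_derivative \<eta>t_r r c A) (at r)" by simp
  have "\<forall>A. ((\<lambda>c. \<eta>t r c A) has_real_derivative \<eta>t_c r c A) (at c)"
    unfolding forall_4 \<eta>t_def \<eta>t_c_def vec4_simps lc_def mc_def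
    by (intro conjI; (rule DERIV_cong, (rule poly_derivs derivs)+, (algebra | (use \<rho>(1) in algebra))))
  then show "((\<lambda>c. \<eta>t r c A) has_real_derivative \<eta>t_c r c A) (at c)" by simp
qed

lemma Ef_deriv_r:
  assumes "Qf r \<noteq> 0"
  shows "((\<lambda>r. Ef r \<theta> A b) has_real_derivative Ef_r r A b) (at r)"
    and "((\<lambda>r. Ef_r r A b) has_real_derivative Ef_rr r A b) (at r)"
proof -
  have "\<forall>A b. ((\<lambda>r. Ef r \<theta> A b) has_real_derivative Ef_r r A b) (at r)"
    unfolding forall_4 Ef_def Ef_r_def vec4_simps
    by (intro conjI; (rule DERIV_cong, (rule poly_derivs Qi_deriv[OF assms])+, (simp; fail | algebra)))
  then show "((\<lambda>r. Ef r \<theta> A b) has_real_derivative Ef_r r A b) (at r)" by simp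
  have "\<forall>A b. ((\<lambda>r. Ef_r r A b) has_real_derivative Ef_rr r A b) (at r)"
    unfolding forall_4 Ef_rr_def Ef_r_def vec4_simps
    by (intro conjI; (rule DERIV_cong, (rule poly_derivs Qi_deriv[OF assms] dQf_deriv)+, (simp; fail | algebra)))
  then show "((\<lambda>r. Ef_r r A b) has_real_derivative Ef_rr r A b) (at r)" by simp
qed

lemma Ef_deriv_\<theta>:
  assumes nz: "Xf (cos \<theta>) \<noteq> 0"
  shows "((\<lambda>\<theta>. Ef r \<theta> A b) has_real_derivative Ef_\<theta> \<theta> A b) (at \<theta>)"
    and "((\<lambda>\<theta>. Ef_\<theta> \<theta> A b) has_real_derivative Ef_\<theta>\<theta> \<theta> A b) (at \<theta>)"
proof -
  note derivs = DERIV_sin DERIV_cos DERIV_cos_comp[OF Xi_deriv[OF nz]] DERIV_cos_comp[OF dXf_deriv]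
  have "\<forall>A b. ((\<lambda>\<theta>. Ef r \<theta> A b) has_real_derivative Ef_\<theta> \<theta> A b) (at \<theta>)"
    unfolding forall_4 Ef_def Ef_\<theta>_def vec4_simps
    by (intro conjI; (rule DERIV_cong, (rule poly_derivs derivs)+, (simp; fail | algebra)))
  then show "((\<lambda>\<theta>. Ef r \<theta> A b) has_real_derivative Ef_\<theta> \<theta> A b) (at \<theta>)" by simp
  have "\<forall>A b. ((\<lambda>\<theta>. Ef_\<theta> \<theta> A b) has_real_derivative Ef_\<theta>\<theta> \<theta> A b) (at \<theta>)"
    unfolding forall_4 Ef_\<theta>\<theta>_def Ef_\<theta>_def vec4_simps
    by (intro conjI; (rule DERIV_cong, (rule poly_derivs derivs)+, (simp; fail | algebra)))
  then show "((\<lambda>\<theta>. Ef_\<theta> \<theta> A b) has_real_derivative Ef_\<theta>\<theta> \<theta> A b) (at \<theta>)" by simp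
qed

lemma ef_deriv:
  assumes nz: "\<rho>f r (cos \<theta>) \<noteq> 0" "\<Omega>f r (cos \<theta>) \<noteq> 0"
  shows "\<exists>D. ((\<lambda>r. ef r \<theta> A b) has_real_derivative D) (at r)"
    and "\<exists>D. ((\<lambda>\<theta>. ef r \<theta> A b) has_real_derivative D) (at \<theta>)"
proof -
  note derivs = DERIV_sin DERIV_cos R_deriv(1)[OF nz] DERIV_cos_comp[OF R_deriv(2)[OF nz]] Qf_deriv
  have "\<forall>A b. \<exists>D. ((\<lambda>r. ef r \<theta> A b) has_real_derivative D) (at r)"
    unfolding forall_4 ef_def vec4_simps
    by (intro conjI; (rule exI, (rule poly_derivs derivs)+))
  then show "\<exists>D. ((\<lambda>r. ef r \<theta> A b) has_real_derivative D) (at r)" by simp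
  have "\<forall>A b. \<exists>D. ((\<lambda>\<theta>. ef r \<theta> A b) has_real_derivative D) (at \<theta>)"
    unfolding forall_4 ef_def vec4_simps Pf_def
    by (intro conjI; (rule exI, (rule poly_derivs derivs)+))
  then show "\<exists>D. ((\<lambda>\<theta>. ef r \<theta> A b) has_real_derivative D) (at \<theta>)" by simp
qed

abbreviation S where "S \<equiv> acc_kerr_domain a \<alpha> m"
abbreviation gk where "gk \<equiv> acc_kerr a \<alpha> m"

lemma domainD:
  assumes "y \<in> S"
  shows "\<Omega>f (y $ 2) (cos (y $ 3)) > 0" "\<rho>f (y $ 2) (cos (y $ 3)) \<noteq> 0" "Qf (y $ 2) \<noteq> 0"
    "Pf (cos (y $ 3)) > 0" "sin (y $ 3) \<noteq> 0" "Xf (cos (y $ 3)) \<noteq> 0"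
    "Xf (cos (y $ 3)) = Pf (cos (y $ 3)) * (sin (y $ 3))\<^sup>2"
    "\<Omega>f (y $ 2) (cos (y $ 3)) \<noteq> 0"
proof -
  show 1: "\<Omega>f (y $ 2) (cos (y $ 3)) > 0" "\<rho>f (y $ 2) (cos (y $ 3)) \<noteq> 0" "Qf (y $ 2) \<noteq> 0"
    "Pf (cos (y $ 3)) > 0" "sin (y $ 3) \<noteq> 0"
    using assms by (simp_all add: acc_kerr_domain_def ak_Omega_def ak_rho2_def ak_Q_def ak_P_def
        \<Omega>f_def \<rho>f_def Qf_def Pf_def mult_ac)
  show "Xf (cos (y $ 3)) = Pf (cos (y $ 3)) * (sin (y $ 3))\<^sup>2"
    by (simp add: Xf_def Pf_def sin_squared_eq)
  with 1 show "Xf (cos (y $ 3)) \<noteq> 0" by simp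
  show "\<Omega>f (y $ 2) (cos (y $ 3)) \<noteq> 0" using 1 by simp
qed

lemma open_domain: "open S"
proof -
  have "S = {x. 0 < ak_Omega \<alpha> (x $ 2) (x $ 3)} \<inter> {x. ak_rho2 a (x $ 2) (x $ 3) \<noteq> 0} \<inter>
     {x. ak_Q a \<alpha> m (x $ 2) \<noteq> 0} \<inter> {x. 0 < ak_P a \<alpha> m (x $ 3)} \<inter> {x. sin (x $ 3) \<noteq> 0}"
    by (auto simp: acc_kerr_domain_def)
  also have "open \<dots>"
    unfolding ak_Omega_def ak_rho2_def ak_Q_def ak_P_def
    by (intro open_Int open_Collect_less open_Collect_neq continuous_intros)
  finally show ?thesis .
qed

lemma torsion_table:
  assumes "\<rho>f r (cos \<theta>) \<noteq> 0" "Qf r \<noteq> 0" "Xf (cos \<theta>) \<noteq> 0"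
  shows "vec4 0 (Ef_r r A d) (Ef_\<theta> \<theta> A d) 0 b - vec4 0 (Ef_r r A b) (Ef_\<theta> \<theta> A b) 0 d
    = (\<Sum>C\<in>UNIV. \<Sum>D\<in>UNIV. Ef r \<theta> C b * (Ef r \<theta> D d * (\<omega>t r (cos \<theta>) A C D - \<omega>t r (cos \<theta>) A D C)))"
proof -
  let ?c = "cos \<theta>"
  \<comment> \<open>This makes sin theta an independent atom, tied to cos theta only by the last
    relation in \<open>id\<close>.\<close>
  define s where "s = sin \<theta>"
  have id: "(r\<^sup>2 + a\<^sup>2 * ?c\<^sup>2) * R r ?c = 1" "Qf r * Qi r = 1" "Xf ?c * Xi ?c = 1" "s\<^sup>2 + ?c\<^sup>2 = 1"
    using assms by (simp_all add: R_def Qi_def Xi_def \<rho>f_def s_def)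
  have "\<forall>A d b. vec4 0 (Ef_r r A d) (Ef_\<theta> \<theta> A d) 0 b - vec4 0 (Ef_r r A b) (Ef_\<theta> \<theta> A b) 0 d
    = (\<Sum>C\<in>UNIV. \<Sum>D\<in>UNIV. Ef r \<theta> C b * (Ef r \<theta> D d * (\<omega>t r ?c A C D - \<omega>t r ?c A D C)))"
    unfolding forall_4 sum_4 Ef_r_def Ef_\<theta>_def Ef_def \<omega>t_def vec4_simps s_def[symmetric] lc_def mc_def lr_def mr_def
    by (intro conjI; (simp; fail | algebra | (use id in algebra)))
  then show ?thesis by blast
qed

lemma metric_table:
  assumes "y \<in> S"
  shows "gk y $ i $ j = (\<Sum>A\<in>UNIV. \<eta>t (y $ 2) (cos (y $ 3)) A * (Ef (y $ 2) (y $ 3) A i * Ef (y $ 2) (y $ 3) A j))"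
proof -
  note d = domainD[OF assms]
  have "\<forall>i j. gk y $ i $ j = (\<Sum>A\<in>UNIV. \<eta>t (y $ 2) (cos (y $ 3)) A * (Ef (y $ 2) (y $ 3) A i * Ef (y $ 2) (y $ 3) A j))"
    unfolding forall_4 sum_4 \<eta>t_def Ef_def vec4_simps acc_kerr_def Let_def
      R_def Oi_def Qi_def Xi_def ak_Omega_def ak_rho2_def
    using d
    by (simp add: axis_def \<rho>f_def \<Omega>f_def ak_Q_def ak_P_def Qf_def Pf_def)
       (simp add: divide_simps power2_eq_square)
  then show ?thesis by blast
qed

lemma dual_table:
  assumes "y \<in> S"
  shows "(\<Sum>b\<in>UNIV. Ef (y $ 2) (y $ 3) A b * ef (y $ 2) (y $ 3) B b) = (if A = B then 1 else 0)"
proof -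
  note d = domainD[OF assms]
  let ?c = "cos (y $ 3)" let ?s = "sin (y $ 3)"
  have id: "((y $ 2)\<^sup>2 + a\<^sup>2 * ?c\<^sup>2) * R (y $ 2) ?c = 1" "Qf (y $ 2) * Qi (y $ 2) = 1" "Pf ?c * ?s\<^sup>2 * Xi ?c = 1" "?s\<^sup>2 + ?c\<^sup>2 = 1"
    using d by (simp_all add: R_def Qi_def Xi_def \<rho>f_def field_simps)
  have "\<forall>A B. (\<Sum>b\<in>UNIV. Ef (y $ 2) (y $ 3) A b * ef (y $ 2) (y $ 3) B b) = (if A = B then 1 else 0)"
    unfolding forall_4 sum_4 Ef_def ef_def vec4_simps
    by (intro conjI; simp?; (algebra | (use id in algebra)))
  then show ?thesis by blast
qed

text \<open>Every coframe entry depends on r alone or on theta alone, hence the zero mixed second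
  derivatives in the table of second derivatives.\<close>

lemma coframe_acc_kerr:
  "coframe gk S (\<lambda>A y. \<eta>t (y $ 2) (cos (y $ 3)) A) (\<lambda>A b y. Ef (y $ 2) (y $ 3) A b)
    (\<lambda>A b y. ef (y $ 2) (y $ 3) A b)
    (\<lambda>c A b y. vec4 0 (Ef_r (y $ 2) A b) (Ef_\<theta> (y $ 3) A b) 0 c)
    (\<lambda>c d A b y. vec4 0 (vec4 0 (Ef_rr (y $ 2) A b) 0 0 d) (vec4 0 0 (Ef_\<theta>\<theta> (y $ 3) A b) 0 d) 0 c)
    (\<lambda>A B C y. \<omega>t (y $ 2) (cos (y $ 3)) A B C) (\<lambda>D A B C y. d\<omega>t (y $ 2) (cos (y $ 3)) D A B C)"
proof
  show "open S" by (rule open_domain)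
next
  fix y i j assume "y \<in> S"
  then show "gk y $ i $ j = (\<Sum>A\<in>UNIV. \<eta>t (y $ 2) (cos (y $ 3)) A * (Ef (y $ 2) (y $ 3) A i * Ef (y $ 2) (y $ 3) A j))"
    by (rule metric_table)
next
  fix y A assume y: "y \<in> S"
  show "\<eta>t (y $ 2) (cos (y $ 3)) A \<noteq> 0"
    using domainD[OF y] exhaust_4[of A] by (auto simp: \<eta>t_def R_def Oi_def)
next
  fix y A B assume "y \<in> S"
  then show "(\<Sum>b\<in>UNIV. Ef (y $ 2) (y $ 3) A b * ef (y $ 2) (y $ 3) B b) = (if A = B then 1 else 0)"
    by (rule dual_table)
next
  fix y c A b assume y: "y \<in> S"
  note d = domainD[OF y]
  show "has_partial c (\<lambda>y. Ef (y $ 2) (y $ 3) A b) y (vec4 0 (Ef_r (y $ 2) A b) (Ef_\<theta> (y $ 3) A b) 0 c)"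
    by (rule has_partial_coords) (intro Ef_deriv_r Ef_deriv_\<theta> d)+
next
  fix y c d A b assume y: "y \<in> S"
  note dom = domainD[OF y]
  have 2: "has_partial c (\<lambda>y. Ef_r (y $ 2) A b) y (vec4 0 (Ef_rr (y $ 2) A b) 0 0 c)"
    by (rule has_partial_coords[of "\<lambda>r \<theta>. Ef_r r A b"]) (rule Ef_deriv_r DERIV_const dom)+
  have 3: "has_partial c (\<lambda>y. Ef_\<theta> (y $ 3) A b) y (vec4 0 0 (Ef_\<theta>\<theta> (y $ 3) A b) 0 c)"
    by (rule has_partial_coords[of "\<lambda>r \<theta>. Ef_\<theta> \<theta> A b"]) (rule Ef_deriv_\<theta> DERIV_const dom)+
  show "has_partial c (\<lambda>y. vec4 0 (Ef_r (y $ 2) A b) (Ef_\<theta> (y $ 3) A b) 0 d) y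
     (vec4 0 (vec4 0 (Ef_rr (y $ 2) A b) 0 0 d) (vec4 0 0 (Ef_\<theta>\<theta> (y $ 3) A b) 0 d) 0 c)"
    using exhaust_4[of c] exhaust_4[of d] 2 3 has_partial_const[of c 0 y] by (elim disjE) simp_all
next
  fix y c d A b
  show "vec4 0 (vec4 0 (Ef_rr (y $ 2) A b) 0 0 d) (vec4 0 0 (Ef_\<theta>\<theta> (y $ 3) A b) 0 d) 0 c
    = vec4 0 (vec4 0 (Ef_rr (y $ 2) A b) 0 0 c) (vec4 0 0 (Ef_\<theta>\<theta> (y $ 3) A b) 0 c) 0 d"
    using exhaust_4[of c] exhaust_4[of d] by (elim disjE) simp_all
next
  fix y c A b assume y: "y \<in> S"
  note d = domainD[OF y]
  obtain D where D: "((\<lambda>r. ef r (y $ 3) A b) has_real_derivative D) (at (y $ 2))"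
    using ef_deriv(1)[OF d(2) d(8)] by blast
  obtain D' where D': "((\<lambda>\<theta>. ef (y $ 2) \<theta> A b) has_real_derivative D') (at (y $ 3))"
    using ef_deriv(2)[OF d(2) d(8)] by blast
  show "\<exists>D. has_partial c (\<lambda>y. ef (y $ 2) (y $ 3) A b) y D"
    using has_partial_coords[of "\<lambda>r \<theta>. ef r \<theta> A b" y, OF D D'] by (rule exI)
next
  fix y c A assume y: "y \<in> S"
  note d = domainD[OF y]
  have id: "Qf (y $ 2) * Qi (y $ 2) = 1" "Xf (cos (y $ 3)) * Xi (cos (y $ 3)) = 1"
    using d(3,6) by (simp_all add: Qi_def Xi_def)
  have "has_partial c (\<lambda>y. \<eta>t (y $ 2) (cos (y $ 3)) A) y
     (vec4 0 (\<eta>t_r (y $ 2) (cos (y $ 3)) A) (- (sin (y $ 3) * \<eta>t_c (y $ 2) (cos (y $ 3)) A)) 0 c)"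
    by (rule has_partial_coords[of "\<lambda>r \<theta>. \<eta>t r (cos \<theta>) A"]) (intro DERIV_cos_comp \<eta>t_deriv d)+
  moreover have "\<forall>c A. vec4 0 (\<eta>t_r (y $ 2) (cos (y $ 3)) A) (- (sin (y $ 3) * \<eta>t_c (y $ 2) (cos (y $ 3)) A)) 0 c
    = (\<Sum>C\<in>UNIV. Ef (y $ 2) (y $ 3) C c *
          (2 * \<eta>t (y $ 2) (cos (y $ 3)) A * \<omega>t (y $ 2) (cos (y $ 3)) A A C))"
    unfolding forall_4 sum_4 Ef_def \<eta>t_def \<eta>t_r_def \<eta>t_c_def \<omega>t_def vec4_simps
    by (intro conjI; (simp; fail | algebra | (use id(1) in algebra) | (use id(2) in algebra)))
  ultimately show "has_partial c (\<lambda>y. \<eta>t (y $ 2) (cos (y $ 3)) A) y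
     (\<Sum>C\<in>UNIV. Ef (y $ 2) (y $ 3) C c *
          (2 * \<eta>t (y $ 2) (cos (y $ 3)) A * \<omega>t (y $ 2) (cos (y $ 3)) A A C))"
    by metis
next
  fix y A B C assume y: "y \<in> S" and AB: "A \<noteq> (B::4)"
  note d = domainD[OF y]
  have id: "\<rho>f (y $ 2) (cos (y $ 3)) * R (y $ 2) (cos (y $ 3)) = 1"
    using d by (simp add: R_def)
  have "\<forall>A B C. A = B \<or> \<eta>t (y $ 2) (cos (y $ 3)) A * \<omega>t (y $ 2) (cos (y $ 3)) A B C
     = - (\<eta>t (y $ 2) (cos (y $ 3)) B * \<omega>t (y $ 2) (cos (y $ 3)) B A C)"
    unfolding forall_4 \<eta>t_def \<omega>t_def vec4_simps
    by (intro conjI; (simp; fail | (rule disjI2, algebra) | (rule disjI2, use id in algebra)))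
  with AB show "\<eta>t (y $ 2) (cos (y $ 3)) A * \<omega>t (y $ 2) (cos (y $ 3)) A B C
     = - (\<eta>t (y $ 2) (cos (y $ 3)) B * \<omega>t (y $ 2) (cos (y $ 3)) B A C)" by blast
next
  fix y c A B C assume y: "y \<in> S"
  note d = domainD[OF y]
  \<comment> \<open>The extra factor \<open>t\<close> lets the simplifier cancel inside products
    nested to the right.\<close>
  have id: "Qi (y $ 2) * (Qf (y $ 2) * t) = t" "Xi (cos (y $ 3)) * (Xf (cos (y $ 3)) * t) = t" for t
    using d(3,6) by (simp_all add: Qi_def Xi_def)
  have "has_partial c (\<lambda>y. \<omega>t (y $ 2) (cos (y $ 3)) A B C) y
     (vec4 0 (\<omega>t_r (y $ 2) (cos (y $ 3)) A B C) (- (sin (y $ 3) * \<omega>t_c (y $ 2) (cos (y $ 3)) A B C)) 0 c)"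
    by (rule has_partial_coords[of "\<lambda>r \<theta>. \<omega>t r (cos \<theta>) A B C"]) (intro DERIV_cos_comp \<omega>t_deriv_r \<omega>t_deriv_c d)+
  moreover have "vec4 0 (\<omega>t_r (y $ 2) (cos (y $ 3)) A B C) (- (sin (y $ 3) * \<omega>t_c (y $ 2) (cos (y $ 3)) A B C)) 0 c
    = (\<Sum>D\<in>UNIV. Ef (y $ 2) (y $ 3) D c * d\<omega>t (y $ 2) (cos (y $ 3)) D A B C)"
    using exhaust_4[of c] by (elim disjE) (simp_all add: sum_4 Ef_def d\<omega>t_def id mult.assoc)
  ultimately show "has_partial c (\<lambda>y. \<omega>t (y $ 2) (cos (y $ 3)) A B C) y
    (\<Sum>D\<in>UNIV. Ef (y $ 2) (y $ 3) D c * d\<omega>t (y $ 2) (cos (y $ 3)) D A B C)"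
    by simp
next
  fix y c A d assume y: "y \<in> S"
  note dom = domainD[OF y]
  show "vec4 0 (Ef_r (y $ 2) A d) (Ef_\<theta> (y $ 3) A d) 0 c - vec4 0 (Ef_r (y $ 2) A c) (Ef_\<theta> (y $ 3) A c) 0 d
    = (\<Sum>C\<in>UNIV. \<Sum>D\<in>UNIV. Ef (y $ 2) (y $ 3) C c * (Ef (y $ 2) (y $ 3) D d *
        (\<omega>t (y $ 2) (cos (y $ 3)) A C D - \<omega>t (y $ 2) (cos (y $ 3)) A D C)))"
    by (rule torsion_table) (rule dom)+
qed

sublocale coframe gk S "\<lambda>A y. \<eta>t (y $ 2) (cos (y $ 3)) A" "\<lambda>A b y. Ef (y $ 2) (y $ 3) A b"
    "\<lambda>A b y. ef (y $ 2) (y $ 3) A b"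
    "\<lambda>c A b y. vec4 0 (Ef_r (y $ 2) A b) (Ef_\<theta> (y $ 3) A b) 0 c"
    "\<lambda>c d A b y. vec4 0 (vec4 0 (Ef_rr (y $ 2) A b) 0 0 d) (vec4 0 0 (Ef_\<theta>\<theta> (y $ 3) A b) 0 d) 0 c"
    "\<lambda>A B C y. \<omega>t (y $ 2) (cos (y $ 3)) A B C" "\<lambda>D A B C y. d\<omega>t (y $ 2) (cos (y $ 3)) D A B C"
  by (rule coframe_acc_kerr)

lemma frame_curvature_eq:
  assumes "y \<in> S" shows "frame_curvature A B C D y = frame_weyl (y $ 2) (cos (y $ 3)) A B C D"
  using frame_curv_eq[of "y $ 2" "cos (y $ 3)" A B C D] domainD[OF assms]
  by (simp add: frame_curvature_def frame_curv_def)

text \<open>The symbol has a repeated index in the trace, and each row of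
  \<open>type_D_weight\<close> sums to 2 - 1 - 1 = 0.\<close>

lemma ricci_flat:
  assumes "y \<in> S" shows "(\<Sum>A\<in>UNIV. frame_curvature A B A D y) = 0"
  unfolding frame_curvature_eq[OF assms]
  using exhaust_4[of B] exhaust_4[of D]
  by (elim disjE) (simp_all add: sum_4 frame_weyl_def type_D_weight_def)

section \<open>Quadratic invariants of a type D tensor\<close>

definition type_D :: "(4 \<Rightarrow> real) \<Rightarrow> real \<Rightarrow> real \<Rightarrow> 4 \<Rightarrow> 4 \<Rightarrow> 4 \<Rightarrow> 4 \<Rightarrow> real" where
  "type_D \<eta> \<kappa> \<nu> A B C D = type_D_weight A B * (((if A = C \<and> B = D then 1 else 0) - (if A = D \<and> B = C then 1 else 0)) * (\<eta> A * \<eta> B * \<kappa>)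
     + levi_civita_symbol A B C D * \<nu>)"

lemma type_D_weight_sym: "type_D_weight A B = type_D_weight B A"
  using exhaust_4[of A] exhaust_4[of B] by (elim disjE; simp add: type_D_weight_def)

text \<open>Duality sends an index pair to the complementary pair, and complementary pairs carry the
  same weight; so dualising preserves the type D shape.\<close>

lemma type_D_weight_complement: "levi_civita_symbol A B P Q * type_D_weight P Q = levi_civita_symbol A B P Q * type_D_weight A B"
  using exhaust_4[of A] exhaust_4[of B] exhaust_4[of P] exhaust_4[of Q]
  by (elim disjE; simp add: levi_civita_symbol_4 type_D_weight_def)

context
  fixes \<eta> :: "4 \<Rightarrow> real" and N :: real
  assumes nz: "\<And>A. \<eta> A \<noteq> 0" and N: "\<eta> 1 * \<eta> 2 * \<eta> 3 * \<eta> 4 = - (N\<^sup>2)" and N_nz: "N \<noteq> 0"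
begin

text \<open>Raising four indices divides the symbol part by the product of the frame metric entries,
  which is -N^2. This Lorentzian minus sign is what makes I1 a difference of squares.\<close>

lemma type_D_raised:
  "type_D \<eta> \<kappa> (N * Y) A B C D / (\<eta> A * \<eta> B) / (\<eta> C * \<eta> D)
    = type_D_weight A B * (((if A = C \<and> B = D then 1 else 0) - (if A = D \<and> B = C then 1 else 0)) * (\<kappa> / (\<eta> A * \<eta> B))
     - levi_civita_symbol A B C D * (Y / N))"
proof -
  have "levi_civita_symbol A B C D * (N * Y) / (\<eta> A * \<eta> B) / (\<eta> C * \<eta> D) = - (levi_civita_symbol A B C D * (Y / N))"
  proof -
    \<comment> \<open>The further factor \<open>N\<close> turns N^2 into minus the product of the
      four frame metric entries without any division.\<close>
    have "levi_civita_symbol A B C D * (N * Y) * N = - (levi_civita_symbol A B C D * (\<eta> A * \<eta> B * (\<eta> C * \<eta> D)) * Y)"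
      unfolding levi_civita_symbol_prod N by (simp add: power2_eq_square)
    then show ?thesis using nz N_nz by (simp add: field_simps)
  qed
  moreover have "((if A = C \<and> B = D then 1 else 0) - (if A = D \<and> B = C then 1 else 0)) * (\<eta> A * \<eta> B * \<kappa>) / (\<eta> A * \<eta> B) / (\<eta> C * \<eta> D)
     = ((if A = C \<and> B = D then 1 else 0) - (if A = D \<and> B = C then 1 else 0)) * (\<kappa> / (\<eta> A * \<eta> B))"
    using nz by (auto simp: field_simps)
  ultimately show ?thesis
    unfolding type_D_def times_divide_eq_right[symmetric] add_divide_distrib by (simp only: distrib_left diff_conv_add_uminus)
qed

text \<open>The squared weights add up to 4 * 4 + 8 * 1 = 24 over ordered pairs, and each pair meets
  two choices of \<open>C\<close>, \<open>D\<close> in the delta part and two in the symbol part;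
  their supports are disjoint, so no cross terms arise. Hence 48.\<close>

lemma type_D_I1:
  "(\<Sum>A\<in>UNIV. \<Sum>B\<in>UNIV. \<Sum>C\<in>UNIV. \<Sum>D\<in>UNIV. type_D \<eta> \<kappa> (N * Y) A B C D *
     (type_D \<eta> \<kappa> (N * Y) A B C D / (\<eta> A * \<eta> B) / (\<eta> C * \<eta> D))) = 48 * (\<kappa>\<^sup>2 - Y\<^sup>2)"
  unfolding type_D_raised
  using nz N_nz by (simp add: sum_4 type_D_def type_D_weight_def levi_civita_symbol_4 power2_eq_square)

lemma type_D_dual:
  "(\<Sum>P\<in>UNIV. \<Sum>Q\<in>UNIV. levi_civita_symbol A B P Q * (type_D \<eta> \<kappa> (N * Y) P Q C D / (\<eta> P * \<eta> Q)))
    = 2 * type_D_weight A B * (levi_civita_symbol A B C D * \<kappa>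
      - ((if A = C \<and> B = D then 1 else 0) - (if A = D \<and> B = C then 1 else 0)) * (\<eta> A * \<eta> B * (Y / N)))"
proof -
  let ?\<delta> = "\<lambda>A B C D. (if A = C \<and> B = D then 1 else 0) - (if A = D \<and> B = C then 1 else 0) :: real"
  have **: "levi_civita_symbol A B P Q * (type_D \<eta> \<kappa> (N * Y) P Q C D / (\<eta> P * \<eta> Q))
      = (levi_civita_symbol A B P Q * type_D_weight P Q * ?\<delta> P Q C D) * \<kappa>
        - (levi_civita_symbol A B P Q * type_D_weight P Q * levi_civita_symbol P Q C D) * (\<eta> A * \<eta> B * (Y / N))" for P Q
  proof -
    have "levi_civita_symbol A B P Q * (N * Y) * N = - (levi_civita_symbol A B P Q * (\<eta> A * \<eta> B * (\<eta> P * \<eta> Q)) * Y)"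
      unfolding levi_civita_symbol_prod N by (simp add: power2_eq_square)
    then have "levi_civita_symbol A B P Q * (N * Y / (\<eta> P * \<eta> Q)) = - (levi_civita_symbol A B P Q * (\<eta> A * \<eta> B * (Y / N)))"
      using nz N_nz by (simp add: field_simps)
    moreover have "type_D \<eta> \<kappa> (N * Y) P Q C D / (\<eta> P * \<eta> Q)
       = type_D_weight P Q * (?\<delta> P Q C D * \<kappa> + levi_civita_symbol P Q C D * (N * Y / (\<eta> P * \<eta> Q)))"
      using nz unfolding type_D_def by (simp add: field_simps)
    moreover have "L * Z = (L * h * d) * \<kappa> - (L * h * L') * T"
      if "L * M = - (L * T)" "Z = h * (d * \<kappa> + L' * M)" for L M T Z h d L' :: real
      using that by algebra
    ultimately show ?thesis by blast
  qed
  have *: "(\<Sum>P\<in>UNIV. \<Sum>Q\<in>UNIV. levi_civita_symbol A B P Q * (type_D \<eta> \<kappa> (N * Y) P Q C D / (\<eta> P * \<eta> Q)))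
     = (\<Sum>P\<in>UNIV. \<Sum>Q\<in>UNIV. levi_civita_symbol A B P Q * type_D_weight P Q * ?\<delta> P Q C D) * \<kappa>
       - (\<Sum>P\<in>UNIV. \<Sum>Q\<in>UNIV. levi_civita_symbol A B P Q * type_D_weight P Q * levi_civita_symbol P Q C D) * (\<eta> A * \<eta> B * (Y / N))"
    by (simp only: ** sum_subtractf sum_distrib_right)
  have sum_delta2: "(\<Sum>P\<in>UNIV. \<Sum>Q\<in>UNIV. f P Q * (if P = U \<and> Q = V then 1 else 0)) = f U V"
    for f :: "4 \<Rightarrow> 4 \<Rightarrow> real" and U V
  proof -
    have "(\<Sum>Q\<in>UNIV. f P Q * (if P = U \<and> Q = V then 1 else 0)) = (if P = U then f P V else 0)" for P
      by (cases "P = U") (simp_all add: if_distrib[where f="\<lambda>x. _ * x"] cong: if_cong)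
    then show ?thesis by simp
  qed
  have "(\<Sum>P\<in>UNIV. \<Sum>Q\<in>UNIV. levi_civita_symbol A B P Q * type_D_weight P Q * ?\<delta> P Q C D)
      = levi_civita_symbol A B C D * type_D_weight C D - levi_civita_symbol A B D C * type_D_weight D C"
    unfolding right_diff_distrib sum_subtractf sum_delta2 ..
  also have "\<dots> = 2 * type_D_weight A B * levi_civita_symbol A B C D"
    using type_D_weight_complement[of A B C D] levi_civita_symbol_antisym[of A B D C] type_D_weight_sym[of D C] by simp
  finally have 1: "(\<Sum>P\<in>UNIV. \<Sum>Q\<in>UNIV. levi_civita_symbol A B P Q * type_D_weight P Q * ?\<delta> P Q C D) = \<dots>" .
  have 2: "(\<Sum>P\<in>UNIV. \<Sum>Q\<in>UNIV. levi_civita_symbol A B P Q * type_D_weight P Q * levi_civita_symbol P Q C D) = 2 * type_D_weight A B * ?\<delta> A B C D"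
  proof -
    have "levi_civita_symbol A B P Q * type_D_weight P Q * levi_civita_symbol P Q C D
        = type_D_weight A B * (levi_civita_symbol A B P Q * levi_civita_symbol P Q C D)" for P Q
      unfolding type_D_weight_complement by (simp only: mult_ac)
    then show ?thesis
      using levi_civita_symbol_sum[of A B C D] by (simp only: sum_distrib_left[symmetric] mult_ac)
  qed
  show ?thesis unfolding * 1 2 by algebra
qed

text \<open>Duality exchanges the delta part and the symbol part, so only mixed products of kappa
  and Y survive. The constant is 2 * 24 * (2 + 2) = 192.\<close>

lemma type_D_I2:
  "(\<Sum>A\<in>UNIV. \<Sum>B\<in>UNIV. \<Sum>C\<in>UNIV. \<Sum>D\<in>UNIV.
     (\<Sum>P\<in>UNIV. \<Sum>Q\<in>UNIV. levi_civita_symbol A B P Q * (type_D \<eta> \<kappa> (N * Y) P Q C D / (\<eta> P * \<eta> Q))) *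
     (type_D \<eta> \<kappa> (N * Y) A B C D / (\<eta> A * \<eta> B) / (\<eta> C * \<eta> D))) = - (192 * (\<kappa> * Y / N))"
  unfolding type_D_raised type_D_dual
  using nz N_nz by (simp add: sum_4 type_D_weight_def levi_civita_symbol_4)

end

text \<open>Since rho^2 = (r + i a c) (r - i a c), the factor \<open>R\<close>^3 turns (r + i a c)^3
  into (r - i a c)^(-3).\<close>

definition \<kappa>f :: "real \<Rightarrow> real \<Rightarrow> real" where "\<kappa>f r c = \<Omega>f r c ^ 3 * uf r c * R r c ^ 3"
definition Yf :: "real \<Rightarrow> real \<Rightarrow> real" where "Yf r c = \<Omega>f r c ^ 3 * vf r c * R r c ^ 3"
text \<open>A root of minus the determinant of the frame metric, chosen without absolute value; it
  has the sign of Q, as X and Omega are positive on the domain.\<close>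

definition Nf :: "real \<Rightarrow> real \<Rightarrow> real" where "Nf r c = Qf r * Xf c * Oi r c ^ 4"

lemma frame_riemann_eq:
  assumes y: "y \<in> S"
  shows "frame_riemann A B C D y = type_D (\<lambda>A. \<eta>t (y $ 2) (cos (y $ 3)) A) (\<kappa>f (y $ 2) (cos (y $ 3)))
    (Nf (y $ 2) (cos (y $ 3)) * Yf (y $ 2) (cos (y $ 3))) A B C D"
proof -
  let ?r = "y $ 2" and ?c = "cos (y $ 3)"
  note d = domainD[OF y]
  have id: "\<rho>f ?r ?c * R ?r ?c = 1" "\<Omega>f ?r ?c * Oi ?r ?c = 1"
    using d by (simp_all add: R_def Oi_def)
  have Kdiag: "\<forall>B. Kdiag ?r ?c B = \<eta>t ?r ?c B * \<kappa>f ?r ?c"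
    unfolding forall_4 Kdiag_def \<eta>t_def \<kappa>f_def vec4_simps
    by (intro conjI; (algebra | (use id in algebra) | (use id(2) in algebra)))
  have Kdual: "\<forall>A. \<eta>t ?r ?c A * Kdual ?r ?c A = Nf ?r ?c * Yf ?r ?c"
    unfolding forall_4 Kdual_def \<eta>t_def Nf_def Yf_def vec4_simps
    by (intro conjI; (algebra | (use id in algebra) | (use id(2) in algebra)))
  have "x * (h * (d * (t * k) + l * e)) = h * (d * (x * t * k) + l * (x * e))" for x h d t k l e :: real
    by algebra
  then show ?thesis
    unfolding frame_riemann_def frame_curvature_eq[OF y] frame_weyl_def type_D_def Kdiag[rule_format] by (simp only: Kdual[rule_format])
qed

lemma \<eta>_prod:
  assumes y: "y \<in> S"
  shows "\<eta>t (y $ 2) (cos (y $ 3)) 1 * \<eta>t (y $ 2) (cos (y $ 3)) 2 * \<eta>t (y $ 2) (cos (y $ 3)) 3 * \<eta>t (y $ 2) (cos (y $ 3)) 4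
    = - ((Nf (y $ 2) (cos (y $ 3)))\<^sup>2)"
proof -
  have id: "\<rho>f (y $ 2) (cos (y $ 3)) * R (y $ 2) (cos (y $ 3)) = 1"
    using domainD[OF y] by (simp_all add: R_def)
  show ?thesis unfolding \<eta>t_def Nf_def vec4_simps using id by algebra
qed

lemma Nf_nz: "y \<in> S \<Longrightarrow> Nf (y $ 2) (cos (y $ 3)) \<noteq> 0"
  using domainD[of y] by (simp add: Nf_def Oi_def)

lemma inv_I1_acc_kerr:
  assumes y: "y \<in> S"
  shows "inv_I1 gk y = 48 * ((\<kappa>f (y $ 2) (cos (y $ 3)))\<^sup>2 - (Yf (y $ 2) (cos (y $ 3)))\<^sup>2)"
  unfolding inv_I1_eq[OF y ricci_flat[OF y]] frame_raised_all_def frame_riemann_eq[OF y]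
  by (rule type_D_I1[OF \<eta>_nz[OF y] \<eta>_prod[OF y] Nf_nz[OF y]])

text \<open>This fixes the orientation: rho^2 and Omega are positive, so only sin theta contributes
  a sign.\<close>

lemma det_Et:
  assumes y: "y \<in> S"
  shows "det (\<chi> A b. Ef (y $ 2) (y $ 3) A b) * Nf (y $ 2) (cos (y $ 3))
    = \<rho>f (y $ 2) (cos (y $ 3)) * Oi (y $ 2) (cos (y $ 3)) ^ 4 * sin (y $ 3)"
proof -
  let ?r = "y $ 2" and ?c = "cos (y $ 3)" and ?s = "sin (y $ 3)"
  have id: "Qf ?r * Qi ?r = 1" "Xf ?c * Xi ?c = 1" "?s\<^sup>2 + ?c\<^sup>2 = 1"
    using domainD(3,6)[OF y] by (simp_all add: Qi_def Xi_def)
  have "det (\<chi> A b. Ef ?r (y $ 3) A b) = (?r\<^sup>2 + a\<^sup>2 * (1 - ?s\<^sup>2)) * Qi ?r * (?s * Xi ?c)"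
    by (simp add: det_4 Ef_def) algebra
  then show ?thesis unfolding Nf_def \<rho>f_def using id by algebra
qed

lemma inv_I2_acc_kerr:
  assumes y: "y \<in> S"
  shows "inv_I2 gk y = - (96 * sgn (sin (y $ 3)) * (\<kappa>f (y $ 2) (cos (y $ 3)) * Yf (y $ 2) (cos (y $ 3))))"
proof -
  let ?N = "Nf (y $ 2) (cos (y $ 3))"
  let ?k = "\<kappa>f (y $ 2) (cos (y $ 3)) * Yf (y $ 2) (cos (y $ 3))"
  define \<Delta> where "\<Delta> = det (\<chi> A b. Ef (y $ 2) (y $ 3) A b)"
  note d = domainD[OF y]
  have N: "?N \<noteq> 0" by (rule Nf_nz[OF y])
  have \<rho>: "\<rho>f (y $ 2) (cos (y $ 3)) > 0"
    using d(2) by (simp add: \<rho>f_def less_le)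
  have \<Delta>N: "sgn (\<Delta> * ?N) = sgn (sin (y $ 3))"
    unfolding \<Delta>_def det_Et[OF y] using d(1) \<rho> by (simp add: sgn_mult Oi_def)
  have \<Delta>: "\<Delta> \<noteq> 0" using \<Delta>N d(5) by (auto simp: sgn_zero_iff)
  have "\<Delta> * inv_I2 gk y = 1/2 * sqrt \<bar>det (gk y)\<bar> * (- (192 * (?k / ?N)))"
    unfolding \<Delta>_def inv_I2_eq[OF y ricci_flat[OF y]] frame_dual_def frame_raised_def frame_raised_all_def frame_riemann_eq[OF y]
    by (subst type_D_I2[OF \<eta>_nz[OF y] \<eta>_prod[OF y] Nf_nz[OF y]]) simp
  also have "det (gk y) = - ((\<Delta> * ?N)\<^sup>2)"
    unfolding det_metric[OF y ricci_flat[OF y]] \<eta>_prod[OF y] \<Delta>_def by (simp add: power_mult_distrib)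
  \<comment> \<open>The positive root is |Delta N| = sgn (Delta N) * (Delta N), and the sign is that
    of sin theta by \<open>\<Delta>N\<close>.\<close>
  also have "sqrt \<bar>- ((\<Delta> * ?N)\<^sup>2)\<bar> = sgn (sin (y $ 3)) * (\<Delta> * ?N)"
    unfolding \<Delta>N[symmetric] abs_minus_cancel abs_power2 real_sqrt_abs by (simp only: abs_sgn mult.commute)
  finally have "\<Delta> * inv_I2 gk y = \<Delta> * - (96 * sgn (sin (y $ 3)) * ?k)"
    using N by (simp add: field_simps)
  then show ?thesis using \<Delta> by (simp only: mult_cancel_left simp_thms)
qed

section \<open>Derivatives of the complex Weyl scalar\<close>

context
  fixes r c :: real
  assumes nz: "\<rho>f r c \<noteq> 0" "\<Omega>f r c \<noteq> 0"
begin

lemma \<rho>R: "\<rho>f r c * R r c = 1" and \<Omega>O: "\<Omega>f r c * Oi r c = 1"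
  using nz by (simp_all add: R_def Oi_def)

text \<open>Real parts of (u + i v)_r = 3 (u + i v) / (r + i a c) and (u + i v)_c = 3 i a (u + i v)
  / (r + i a c), with 1 / (r + i a c) = (r - i a c) \<open>R\<close>. The imaginary parts give
  \<open>vf_deriv\<close>.\<close>

lemma uf_deriv:
  "((\<lambda>r. uf r c) has_real_derivative 3 * (r * uf r c + a * c * vf r c) * R r c) (at r)"
  "((\<lambda>c. uf r c) has_real_derivative 3 * (a\<^sup>2 * c * uf r c - a * r * vf r c) * R r c) (at c)"
proof -
  \<comment> \<open>The bracket is divisible by rho^2, so multiplying by \<open>R\<close> leaves the
    plain derivative of a polynomial.\<close>
  have "3 * (r * uf r c + a * c * vf r c) = m * (3 * r\<^sup>2 - 3 * a\<^sup>2 * c\<^sup>2 - \<alpha> * a * (6 * r * a * c)) * \<rho>f r c"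
    unfolding uf_def vf_def \<rho>f_def by algebra
  then have 1: "3 * (r * uf r c + a * c * vf r c) * R r c = m * (3 * r\<^sup>2 - 3 * a\<^sup>2 * c\<^sup>2 - \<alpha> * a * (6 * r * a * c))"
    by (simp add: mult.assoc \<rho>R)
  have "3 * (a\<^sup>2 * c * uf r c - a * r * vf r c) = m * (- (6 * r * a\<^sup>2 * c) - \<alpha> * a * (3 * r\<^sup>2 * a - 3 * a^3 * c\<^sup>2)) * \<rho>f r c"
    unfolding uf_def vf_def \<rho>f_def by algebra
  then have 2: "3 * (a\<^sup>2 * c * uf r c - a * r * vf r c) * R r c = m * (- (6 * r * a\<^sup>2 * c) - \<alpha> * a * (3 * r\<^sup>2 * a - 3 * a^3 * c\<^sup>2))"
    by (simp add: mult.assoc \<rho>R)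
  show "((\<lambda>r. uf r c) has_real_derivative 3 * (r * uf r c + a * c * vf r c) * R r c) (at r)"
    unfolding 1 unfolding uf_def by (rule DERIV_cong, (rule poly_derivs)+, algebra)
  show "((\<lambda>c. uf r c) has_real_derivative 3 * (a\<^sup>2 * c * uf r c - a * r * vf r c) * R r c) (at c)"
    unfolding 2 unfolding uf_def by (rule DERIV_cong, (rule poly_derivs)+, algebra)
qed

lemma vf_deriv:
  "((\<lambda>r. vf r c) has_real_derivative 3 * (r * vf r c - a * c * uf r c) * R r c) (at r)"
  "((\<lambda>c. vf r c) has_real_derivative 3 * (a\<^sup>2 * c * vf r c + a * r * uf r c) * R r c) (at c)"
proof -
  have "3 * (r * vf r c - a * c * uf r c) = m * (6 * r * a * c + \<alpha> * a * (3 * r\<^sup>2 - 3 * a\<^sup>2 * c\<^sup>2)) * \<rho>f r c"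
    unfolding uf_def vf_def \<rho>f_def by algebra
  then have 1: "3 * (r * vf r c - a * c * uf r c) * R r c = m * (6 * r * a * c + \<alpha> * a * (3 * r\<^sup>2 - 3 * a\<^sup>2 * c\<^sup>2))"
    by (simp add: mult.assoc \<rho>R)
  have "3 * (a\<^sup>2 * c * vf r c + a * r * uf r c) = m * (3 * r\<^sup>2 * a - 3 * a^3 * c\<^sup>2 - \<alpha> * a * (6 * r * a\<^sup>2 * c)) * \<rho>f r c"
    unfolding uf_def vf_def \<rho>f_def by algebra
  then have 2: "3 * (a\<^sup>2 * c * vf r c + a * r * uf r c) * R r c = m * (3 * r\<^sup>2 * a - 3 * a^3 * c\<^sup>2 - \<alpha> * a * (6 * r * a\<^sup>2 * c))"
    by (simp add: mult.assoc \<rho>R)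
  show "((\<lambda>r. vf r c) has_real_derivative 3 * (r * vf r c - a * c * uf r c) * R r c) (at r)"
    unfolding 1 unfolding vf_def by (rule DERIV_cong, (rule poly_derivs)+, algebra)
  show "((\<lambda>c. vf r c) has_real_derivative 3 * (a\<^sup>2 * c * vf r c + a * r * uf r c) * R r c) (at c)"
    unfolding 2 unfolding vf_def by (rule DERIV_cong, (rule poly_derivs)+, algebra)
qed

lemma \<Omega>f_deriv:
  "((\<lambda>r. \<Omega>f r c) has_real_derivative - (\<alpha> * c)) (at r)"
  "((\<lambda>c. \<Omega>f r c) has_real_derivative - (\<alpha> * r)) (at c)"
  unfolding \<Omega>f_def by (rule DERIV_cong, (rule poly_derivs)+, algebra)+

text \<open>With z = kappa + i Y, these are the real parts of z_r = -3 (\<open>lr\<close> + i a c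
  \<open>R\<close>) z and z_c = 3 (-\<open>lc\<close> + i a r \<open>R\<close>) z; the imaginary
  parts follow in \<open>Yf_deriv\<close>.\<close>

lemma \<kappa>f_deriv:
  "((\<lambda>r. \<kappa>f r c) has_real_derivative 3 * (Yf r c * (a * c * R r c) - \<kappa>f r c * lr r c)) (at r)"
  "((\<lambda>c. \<kappa>f r c) has_real_derivative - (3 * (\<kappa>f r c * lc r c + Yf r c * (a * r * R r c)))) (at c)"
  unfolding \<kappa>f_def Yf_def lr_def lc_def
  by (rule DERIV_cong, (rule poly_derivs uf_deriv \<Omega>f_deriv R_deriv[OF nz])+, use \<Omega>O in algebra)+

lemma Yf_deriv:
  "((\<lambda>r. Yf r c) has_real_derivative - (3 * (\<kappa>f r c * (a * c * R r c) + Yf r c * lr r c))) (at r)"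
  "((\<lambda>c. Yf r c) has_real_derivative 3 * (\<kappa>f r c * (a * r * R r c) - Yf r c * lc r c)) (at c)"
  unfolding \<kappa>f_def Yf_def lr_def lc_def
  by (rule DERIV_cong, (rule poly_derivs vf_deriv \<Omega>f_deriv R_deriv[OF nz])+, use \<Omega>O in algebra)+

text \<open>Squared modulus of the Weyl scalar, from |1 + i alpha a|^2 = 1 + alpha^2 a^2 and |r + i
  a c|^2 = rho^2.\<close>

lemma \<kappa>_Y_norm: "(\<kappa>f r c)\<^sup>2 + (Yf r c)\<^sup>2 = \<Omega>f r c ^ 6 * m\<^sup>2 * (1 + \<alpha>\<^sup>2 * a\<^sup>2) * R r c ^ 3"
proof -
  have "(uf r c)\<^sup>2 + (vf r c)\<^sup>2 = m\<^sup>2 * (1 + \<alpha>\<^sup>2 * a\<^sup>2) * \<rho>f r c ^ 3"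
    unfolding uf_def vf_def \<rho>f_def by algebra
  then show ?thesis unfolding \<kappa>f_def Yf_def using \<rho>R by algebra
qed

text \<open>The \<open>R\<close> parts add up to 1 and the \<open>Oi\<close> parts to 2 alpha r c /
  Omega. This is the source of the factor (alpha r cos theta + 1)^2 in Q2.\<close>

lemma lr_lc: "lr r c * r + lc r c * c = Oi r c * (1 + \<alpha> * r * c)"
  using \<rho>R \<Omega>O unfolding lr_def lc_def \<rho>f_def \<Omega>f_def by algebra

end

section \<open>The Gram determinant of dI1 and dI2, and the value of Q2\<close>

context
  fixes x :: "real^4"
  assumes x: "x \<in> S"
begin

abbreviation (input) "rx \<equiv> x $ 2"
abbreviation (input) "cx \<equiv> cos (x $ 3)"

text \<open>The constant is 6 * 48, six being the exponent of w in I1 + i I2; the factor sin theta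
  comes from dc = - sin theta dtheta.\<close>

lemma I1_partial: "partial i (inv_I1 gk) x = vec4 0
    (288 * (Yf rx cx * (\<kappa>f rx cx * (a * cx * R rx cx)) * 2 - ((\<kappa>f rx cx)\<^sup>2 - (Yf rx cx)\<^sup>2) * lr rx cx))
    (sin (x $ 3) * (288 * (Yf rx cx * (\<kappa>f rx cx * (a * rx * R rx cx)) * 2 + ((\<kappa>f rx cx)\<^sup>2 - (Yf rx cx)\<^sup>2) * lc rx cx))) 0 i"
proof -
  let ?h = "\<lambda>r \<theta>. 48 * ((\<kappa>f r (cos \<theta>))\<^sup>2 - (Yf r (cos \<theta>))\<^sup>2)"
  note d = domainD[OF x]
  note der = \<kappa>f_deriv[OF d(2) d(8)] Yf_deriv[OF d(2) d(8)]
  have "has_partial i (\<lambda>y. ?h (y $ 2) (y $ 3)) x (vec4 0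
    (288 * (Yf rx cx * (\<kappa>f rx cx * (a * cx * R rx cx)) * 2 - ((\<kappa>f rx cx)\<^sup>2 - (Yf rx cx)\<^sup>2) * lr rx cx))
    (sin (x $ 3) * (288 * (Yf rx cx * (\<kappa>f rx cx * (a * rx * R rx cx)) * 2 + ((\<kappa>f rx cx)\<^sup>2 - (Yf rx cx)\<^sup>2) * lc rx cx))) 0 i)"
    by (rule has_partial_coords[of ?h]; rule DERIV_cong, (rule poly_derivs der DERIV_cos_comp[OF der(2)] DERIV_cos_comp[OF der(4)])+, algebra)
  then show ?thesis
    using partial_cong_open[OF open_domain x inv_I1_acc_kerr, where i=i] by (simp add: partial_eqI)
qed

lemma I2_partial: "partial i (inv_I2 gk) x = vec4 0
    (288 * sgn (sin (x $ 3)) * (((\<kappa>f rx cx)\<^sup>2 - (Yf rx cx)\<^sup>2) * (a * cx * R rx cx) + 2 * \<kappa>f rx cx * Yf rx cx * lr rx cx))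
    (sin (x $ 3) * (288 * sgn (sin (x $ 3)) * (((\<kappa>f rx cx)\<^sup>2 - (Yf rx cx)\<^sup>2) * (a * rx * R rx cx) - 2 * \<kappa>f rx cx * Yf rx cx * lc rx cx))) 0 i"
proof -
  let ?\<sigma> = "sgn (sin (x $ 3))"
  let ?h = "\<lambda>r \<theta>. - (96 * ?\<sigma> * (\<kappa>f r (cos \<theta>) * Yf r (cos \<theta>)))"
  note d = domainD[OF x]
  note der = \<kappa>f_deriv[OF d(2) d(8)] Yf_deriv[OF d(2) d(8)]
  \<comment> \<open>On this smaller open set sin theta keeps its sign, so the orientation factor in
    I2 is constant and may be differentiated as such.\<close>
  let ?T = "S \<inter> {y. 0 < ?\<sigma> * sin (y $ 3)}"
  have T: "open ?T"
    by (intro open_Int open_domain open_Collect_less continuous_intros)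
  have xT: "x \<in> ?T" using x d(5) by (simp add: abs_sgn[symmetric] mult.commute[of "sgn _"])
  have I2: "inv_I2 gk y = ?h (y $ 2) (y $ 3)" if "y \<in> ?T" for y
  proof -
    have "sgn (sin (y $ 3)) = ?\<sigma>"
      using that d(5) by (auto simp: sgn_if zero_less_mult_iff split: if_splits)
    then show ?thesis using inv_I2_acc_kerr[of y] that by simp
  qed
  have "has_partial i (\<lambda>y. ?h (y $ 2) (y $ 3)) x (vec4 0
    (288 * sgn (sin (x $ 3)) * (((\<kappa>f rx cx)\<^sup>2 - (Yf rx cx)\<^sup>2) * (a * cx * R rx cx) + 2 * \<kappa>f rx cx * Yf rx cx * lr rx cx))
    (sin (x $ 3) * (288 * sgn (sin (x $ 3)) * (((\<kappa>f rx cx)\<^sup>2 - (Yf rx cx)\<^sup>2) * (a * rx * R rx cx) - 2 * \<kappa>f rx cx * Yf rx cx * lc rx cx))) 0 i)"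
    by (rule has_partial_coords[of ?h]; rule DERIV_cong, (rule poly_derivs der DERIV_cos_comp[OF der(2)] DERIV_cos_comp[OF der(4)])+, algebra)
  then show ?thesis
    using partial_cong_open[OF T xT I2, where i=i] by (simp add: partial_eqI)
qed

lemma contract_eq:
  assumes "u $ 1 = 0" "u $ 4 = 0" "v $ 1 = 0" "v $ 4 = 0"
  shows "contract gk x u v = inv_metric gk x $ 2 $ 2 * (u $ 2 * v $ 2) + inv_metric gk x $ 3 $ 3 * (u $ 3 * v $ 3)"
proof -
  have "inv_metric gk x $ 2 $ 3 = 0" "inv_metric gk x $ 3 $ 2 = 0"
    by (simp_all add: inv_metric_eq[OF x] sum_4 ef_def)
  then show ?thesis unfolding contract_def by (simp add: sum_4 assms)
qed

text \<open>Lagrange's identity: both covectors have only r and theta components and the inverse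
  metric is diagonal there, so the Gram determinant is the determinant of that block times a squared
  2 by 2 minor.\<close>

lemma gram:
  "inv_I5 gk x * inv_I6 gk x - (inv_I7 gk x)\<^sup>2 = (inv_metric gk x $ 2 $ 2 * inv_metric gk x $ 3 $ 3) *
    (covec_k gk x $ 2 * covec_l gk x $ 3 - covec_k gk x $ 3 * covec_l gk x $ 2)\<^sup>2"
proof -
  have 0: "covec_k gk x $ 1 = 0" "covec_k gk x $ 4 = 0" "covec_l gk x $ 1 = 0" "covec_l gk x $ 4 = 0"
    by (simp_all add: covec_k_def covec_l_def I1_partial I2_partial)
  show ?thesis
    unfolding inv_I5_def inv_I6_def inv_I7_def contract_eq[OF 0(1,2,1,2)] contract_eq[OF 0(3,4,3,4)] contract_eq[OF 0]
    by algebra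
qed

text \<open>Here 82944 = 36 * 48^2, and the two partial derivatives combine to r \<open>lr\<close> +
  c \<open>lc\<close>, evaluated by \<open>lr_lc\<close>. Squaring removes the orientation
  sign.\<close>

lemma jacobian:
  "(covec_k gk x $ 2 * covec_l gk x $ 3 - covec_k gk x $ 3 * covec_l gk x $ 2)\<^sup>2 =
    (82944 * ((\<kappa>f rx cx)\<^sup>2 + (Yf rx cx)\<^sup>2)\<^sup>2 * a * R rx cx * Oi rx cx * (1 + \<alpha> * rx * cx))\<^sup>2 * (sin (x $ 3))\<^sup>2"
proof -
  note d = domainD[OF x]
  let ?\<sigma> = "sgn (sin (x $ 3))"
  have \<sigma>: "?\<sigma>\<^sup>2 = 1" using d(5) by (simp add: sgn_if)
  have "covec_k gk x $ 2 * covec_l gk x $ 3 - covec_k gk x $ 3 * covec_l gk x $ 2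
     = - (?\<sigma> * sin (x $ 3) * (82944 * ((\<kappa>f rx cx)\<^sup>2 + (Yf rx cx)\<^sup>2)\<^sup>2 * a * R rx cx * (lr rx cx * rx + lc rx cx * cx)))"
    unfolding covec_k_def covec_l_def I1_partial I2_partial vec_lambda_beta vec4_simps by algebra
  then show ?thesis
    using \<sigma> unfolding lr_lc[OF d(2) d(8)] by (simp add: power_mult_distrib)
qed

lemma inv_metric_prod:
  "inv_metric gk x $ 2 $ 2 * inv_metric gk x $ 3 $ 3 = Qf rx * Pf cx * (R rx cx)\<^sup>2 * \<Omega>f rx cx ^ 4"
proof -
  note d = domainD[OF x]
  have "inv_metric gk x $ 2 $ 2 = Qf rx * (Qf rx / \<eta>t rx cx 2)"
    by (simp add: inv_metric_eq[OF x] sum_4 ef_def)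
  also have "\<dots> = Qf rx * R rx cx * (\<Omega>f rx cx)\<^sup>2"
    using d(1-3) by (simp add: \<eta>t_def R_def Oi_def field_simps)
  finally have 2: "inv_metric gk x $ 2 $ 2 = \<dots>" .
  have "inv_metric gk x $ 3 $ 3 = (Pf cx * sin (x $ 3)) * ((Pf cx * sin (x $ 3)) / \<eta>t rx cx 3)"
    by (simp add: inv_metric_eq[OF x] sum_4 ef_def)
  also have "\<dots> = Pf cx * R rx cx * (\<Omega>f rx cx)\<^sup>2"
    using d(1,2,4,5) by (simp add: \<eta>t_def d(7) R_def Oi_def field_simps) (simp add: power2_eq_square)
  finally have 3: "inv_metric gk x $ 3 $ 3 = \<dots>" .
  show ?thesis unfolding 2 3 by algebra
qed

lemma inv_Q2_acc_kerr:
  assumes m: "m \<noteq> 0"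
  shows "inv_Q2 gk x = Qf rx * Pf cx * (sin (x $ 3))\<^sup>2 * a\<^sup>2 * (1 + \<alpha> * rx * cx)\<^sup>2
    / (\<Omega>f rx cx ^ 4 * \<rho>f rx cx * m\<^sup>2 * (1 + \<alpha>\<^sup>2 * a\<^sup>2))"
proof -
  note d = domainD[OF x]
  define Z where "Z = (\<kappa>f rx cx)\<^sup>2 + (Yf rx cx)\<^sup>2"
  have \<rho>: "\<rho>f rx cx > 0" using d(2) by (simp add: \<rho>f_def less_le)
  have Z: "Z = \<Omega>f rx cx ^ 6 * m\<^sup>2 * (1 + \<alpha>\<^sup>2 * a\<^sup>2) * R rx cx ^ 3"
    unfolding Z_def by (rule \<kappa>_Y_norm[OF d(2) d(8)])
  have ma: "1 + \<alpha>\<^sup>2 * a\<^sup>2 > 0"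
    by (simp add: add_pos_nonneg)
  \<comment> \<open>Positivity is what turns the real power 5/2 of (48 Z)^2 into (48 Z)^5, and it
    rests on m being nonzero.\<close>
  have Z_pos: "Z > 0"
    unfolding Z R_def using d(1) \<rho> m ma by simp
  have \<sigma>: "(sgn (sin (x $ 3)))\<^sup>2 = 1" using d(5) by (simp add: sgn_if)
  \<comment> \<open>The modulus of z^2 is |z|^2: (kappa^2 - Y^2)^2 + (2 kappa Y)^2 = (kappa^2 +
    Y^2)^2.\<close>
  have "(inv_I1 gk x)\<^sup>2 + (inv_I2 gk x)\<^sup>2 = (48 * Z)\<^sup>2"
    unfolding inv_I1_acc_kerr[OF x] inv_I2_acc_kerr[OF x] Z_def using \<sigma> by algebra
  moreover have "t\<^sup>2 powr (5/2) = t ^ 5" if "t > 0" for t :: real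
  proof -
    have "(t powr 2) powr (5/2) = t powr 5" by (simp only: powr_powr) simp
    with that show ?thesis by simp
  qed
  ultimately have pw: "((inv_I1 gk x)\<^sup>2 + (inv_I2 gk x)\<^sup>2) powr (5/2) = (48 * Z) ^ 5"
    using Z_pos by (simp only: mult_pos_pos zero_less_numeral)
  have "inv_Q2 gk x = (1/27) * ((Qf rx * Pf cx * (R rx cx)\<^sup>2 * \<Omega>f rx cx ^ 4 *
      ((82944 * Z\<^sup>2 * a * R rx cx * Oi rx cx * (1 + \<alpha> * rx * cx))\<^sup>2 * (sin (x $ 3))\<^sup>2)) / (48 * Z) ^ 5)"
    unfolding inv_Q2_def gram jacobian inv_metric_prod pw Z_def ..
  \<comment> \<open>All numerical constants cancel: 36^2 * 48^4 / (27 * 48^5) = 1. Of the powers of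
    Z only Z^4 / Z^5 remains.\<close>
  also have "\<dots> = Qf rx * Pf cx * (sin (x $ 3))\<^sup>2 * a\<^sup>2 * (1 + \<alpha> * rx * cx)\<^sup>2 * (R rx cx ^ 4 * \<Omega>f rx cx ^ 4 * (Oi rx cx)\<^sup>2 / Z)"
    using Z_pos by (simp add: power_mult_distrib power2_eq_square eval_nat_numeral)
  also have "R rx cx ^ 4 * \<Omega>f rx cx ^ 4 * (Oi rx cx)\<^sup>2 / Z = 1 / (\<Omega>f rx cx ^ 4 * \<rho>f rx cx * m\<^sup>2 * (1 + \<alpha>\<^sup>2 * a\<^sup>2))"
  proof -
    have "inverse t ^ 4 * w ^ 4 * (inverse w)\<^sup>2 / (w ^ 6 * m\<^sup>2 * M * inverse t ^ 3) = 1 / (w ^ 4 * t * m\<^sup>2 * M)"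
      if "t > 0" "w > 0" "M > 0" for t w M :: real
      using that m by (simp add: field_simps eval_nat_numeral)
    from this[OF \<rho> d(1) ma] show ?thesis unfolding Z R_def Oi_def .
  qed
  finally show ?thesis by simp
qed

end
end

theorem theorem46:
  fixes a \<alpha> m :: real and x :: "real^4" and r \<theta> :: real
  defines "r \<equiv> x $ 2" and "\<theta> \<equiv> x $ 3"
  assumes "m \<noteq> 0" and "x \<in> acc_kerr_domain a \<alpha> m"
  shows "inv_Q2 (acc_kerr a \<alpha> m) x =
    - (((a\<^sup>2 - 2 * m * r + r\<^sup>2) * (a\<^sup>2 * \<alpha>\<^sup>2 * (cos \<theta>)\<^sup>2 - 2 * \<alpha> * m * cos \<theta> + 1) * (sin \<theta>)\<^sup>2 * a\<^sup>2
         * (\<alpha> * r * cos \<theta> + 1)\<^sup>2 * (\<alpha>\<^sup>2 * r\<^sup>2 - 1))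
       / ((\<alpha> * r * cos \<theta> - 1)^4 * (r\<^sup>2 + a\<^sup>2 * (cos \<theta>)\<^sup>2) * m\<^sup>2 * (a\<^sup>2 * \<alpha>\<^sup>2 + 1)))"
proof -
  interpret acc_kerr_params a \<alpha> m .
  \<comment> \<open>The overall minus sign of the claim comes from writing 1 - alpha^2 r^2 as
    -(alpha^2 r^2 - 1); in the denominator the fourth power absorbs the reversed sign of
    Omega.\<close>
  have num: "Qf r * Pf (cos \<theta>) * (sin \<theta>)\<^sup>2 * a\<^sup>2 * (1 + \<alpha> * r * cos \<theta>)\<^sup>2
      = - ((a\<^sup>2 - 2 * m * r + r\<^sup>2) * (a\<^sup>2 * \<alpha>\<^sup>2 * (cos \<theta>)\<^sup>2 - 2 * \<alpha> * m * cos \<theta> + 1) * (sin \<theta>)\<^sup>2 * a\<^sup>2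
         * (\<alpha> * r * cos \<theta> + 1)\<^sup>2 * (\<alpha>\<^sup>2 * r\<^sup>2 - 1))"
    unfolding Qf_def Pf_def by algebra
  have den: "\<Omega>f r (cos \<theta>) ^ 4 * \<rho>f r (cos \<theta>) * m\<^sup>2 * (1 + \<alpha>\<^sup>2 * a\<^sup>2)
      = (\<alpha> * r * cos \<theta> - 1)^4 * (r\<^sup>2 + a\<^sup>2 * (cos \<theta>)\<^sup>2) * m\<^sup>2 * (a\<^sup>2 * \<alpha>\<^sup>2 + 1)"
    unfolding \<Omega>f_def \<rho>f_def by algebra
  show ?thesis
    using inv_Q2_acc_kerr[OF assms(4,3)] unfolding r_def[symmetric] \<theta>_def[symmetric] num den by simp
qed

end
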